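(* Let $(\sigma^{1}_n)_{n\geq 1}$ and $(\sigma^{2}_n)_{n\geq 1}$ be two sequences of random permutations such that $\sigma^{1}_n,\sigma^2_n \in \mathfrak{S}_n$ for every $n\geq 1$. For $v \geq 1$, let $t^n_v:=\#_v(\sigma^{1}_n\sigma^2_n)$. Assume that: (1) for every $n\geq 1$, $\sigma^1_n$ and $\sigma^{2}_n$ are independent; (2) for all $\ell\in\{1,2\}$ except possibly one, the following holds: for every $n\geq 1$ and every $\sigma \in \mathfrak{S}_n$, $\sigma^{-1}\sigma_n^\ell\sigma\overset{d}{=}\sigma_n^\ell$; (3) for every $k \geq 1$, $$\lim_{n\to\infty} \mathbb{E}\left(\left(\frac{\#_1 \,\sigma^{1}_n}{\sqrt n}\right)^k\right)=0 \quad\text{and}\quad \lim_{n\to\infty} \mathbb{E}\left(\left(\frac{\#_1 \,\sigma^{2}_n}{\sqrt n}\right)^k\right) =0.$$ Then for every $v\geq 1$, $$\lim_{n\to\infty}\mathbb{E}(t^n_v)= \frac{1}{v}.$$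
   Context: $\mathfrak{S}_n$ is the group of permutations of $\{1,\dots,n\}$. For $\sigma\in\mathfrak{S}_n$ and $k\ge 1$, $\#_k\,\sigma$ is the number of cycles of $\sigma$ of length $k$ (so $\#_1\sigma$ is the number of fixed points). $\overset{d}{=}$ denotes equality in distribution. *)

theory Defs
  imports "HOL-Probability.Probability" "HOL-Combinatorics.Orbits"
begin

text \<open>
  The symmetric group on \<open>{1..n}\<close> as a discrete measurable space; permutations are
  functions on all naturals that are the identity outside \<open>{1..n}\<close>.
\<close>
definition perm_space :: "nat \<Rightarrow> (nat \<Rightarrow> nat) measure" where
  "perm_space n = count_space {p. p permutes {1..n}}"

text \<open>
  A cycle is identified with its underlying set. Restricting to subsets of \<open>{1..n}\<close>
  excludes the fixed points outside \<open>{1..n}\<close>.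
\<close>
definition cycle_count :: "nat \<Rightarrow> nat \<Rightarrow> (nat \<Rightarrow> nat) \<Rightarrow> nat" where
  "cycle_count n k p = card {C. C \<subseteq> {1..n} \<and> cyclic_on p C \<and> card C = k}"

lemma cycle_count_1: "cycle_count n 1 p = card {i \<in> {1..n}. p i = i}"
proof -
  have orb: "orbit p i = {i} \<longleftrightarrow> p i = i" for i
  proof
    show "orbit p i = {i} \<Longrightarrow> p i = i"
      using orbit.base[of p i] by simp
    assume "p i = i"
    have "y = i" if "y \<in> orbit p i" for y
      using that by (induction rule: orbit.induct) (simp_all add: \<open>p i = i\<close>)
    with orbit.base[of p i] \<open>p i = i\<close> show "orbit p i = {i}" by auto
  qed
  have "{C. C \<subseteq> {1..n} \<and> cyclic_on p C \<and> card C = 1} = (\<lambda>i. {i}) ` {i \<in> {1..n}. p i = i}"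
    unfolding cyclic_on_def by (auto simp: card_1_singleton_iff orb eq_commute[of "{_}" "orbit _ _"])
  then show ?thesis
    by (simp add: cycle_count_def card_image)
qed

end

theory Submission
  imports Defs "HOL-Real_Asymp.Real_Asymp"
begin

text \<open>
  If \<open>p\<close> is conjugation invariant and independent of \<open>r\<close>, then \<open>p\<close> may be replaced by
  \<open>inv \<tau> \<circ> p \<circ> \<tau>\<close> with \<open>\<tau>\<close> uniform and independent of everything else. So it is enough to
  understand, for two fixed permutations \<open>s\<close> and \<open>r\<close>, the average over \<open>\<tau>\<close> of the number of cycles
  of length \<open>v\<close> of \<open>inv \<tau> \<circ> s \<circ> \<tau> \<circ> r\<close>, with an error that is polynomial in the numbers of fixed
  points of \<open>s\<close> and \<open>r\<close> divided by \<open>sqrt n\<close>; the moment hypothesis then makes the expected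
  error vanish. If instead \<open>r\<close> is the conjugation invariant factor, the two are exchanged, as
  \<open>s \<circ> r\<close> and \<open>r \<circ> s\<close> have the same cycle counts.

  Each cycle of length \<open>v\<close> is counted by \<open>v\<close> injective tuples \<open>x\<close> with
  \<open>s (\<tau> (r (x i))) = \<tau> (x (i + 1))\<close>, indices modulo \<open>v\<close>. Summing over \<open>\<tau>\<close> first, the tuples are
  sorted by their pattern of coincidences \<open>x i = r (x j)\<close>. For generic tuples, without
  coincidences, the number of tuples is about \<open>n ^ v\<close>, and \<open>\<tau>\<close> maps the \<open>2 * v\<close> points involved to
  one of about \<open>n ^ v\<close> generic configurations for \<open>s\<close>. Their contribution is therefore about
  \<open>n ^ (2 * v) * fact (n - 2 * v) / fact n\<close>, which tends to 1.

  For a pattern with \<open>d\<close> distinct points, the probability that \<open>\<tau>\<close> takes given values on them is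
  of order \<open>n ^ (- d)\<close>, and one counts the ways to place the points compatibly with \<open>r\<close> and with \<open>s\<close>.
  Each of the two sets of edges splits the \<open>d\<close> points into components. A component has at most
  \<open>n\<close> placements, or as many as there are fixed points if it is a loop. If there are
  \<open>o(sqrt n)\<close> fixed points, this is at most of order \<open>sqrt n\<close> to the number of its points,
  and this order is reached only for two points. So the two placement counts multiply to at most
  order \<open>n ^ d\<close>, and the contribution is negligible unless all components of both edge sets have
  exactly two points. By lemma \<open>two_point_components_disjoint\<close> this forces the pattern to be
  generic. The estimates are combined in lemma \<open>average_cyclic_tuples_bound\<close>.
\<close>

section \<open>Cycles as cyclic injective tuples\<close>

definition cyclic_tuples :: "nat \<Rightarrow> nat \<Rightarrow> (nat \<Rightarrow> nat) \<Rightarrow> (nat \<Rightarrow> nat) set" where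
  "cyclic_tuples n v p =
    {x \<in> {..<v} \<rightarrow>\<^sub>E {1..n}. inj_on x {..<v} \<and> (\<forall>i<v. p (x i) = x (Suc i mod v))}"

lemma card_points_in_cycles:
  assumes p: "p permutes {1..n}"
  shows "card {a \<in> {1..n}. card (orbit p a) = v} = v * cycle_count n v p"
proof -
  let ?F = "{C. C \<subseteq> {1..n} \<and> cyclic_on p C \<and> card C = v}"
  have self: "a \<in> orbit p a" for a
    using p permutation_self_in_orbit permutation_permutes finite_atLeastAtMost by metis
  have orb: "cyclic_on p C \<Longrightarrow> a \<in> C \<Longrightarrow> C = orbit p a" for C a
    using orbit_cyclic_eq3 by metis
  have "{a \<in> {1..n}. card (orbit p a) = v} = \<Union>?F"
  proof (intro set_eqI iffI)
    fix a assume a: "a \<in> {a \<in> {1..n}. card (orbit p a) = v}"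
    then have "orbit p a \<in> ?F"
      using permutes_orbit_subset[OF p] cyclic_on_orbit[OF p] by auto
    then show "a \<in> \<Union>?F" using self[of a] by blast
  next
    fix a assume "a \<in> \<Union>?F"
    then show "a \<in> {a \<in> {1..n}. card (orbit p a) = v}" using orb by blast
  qed
  moreover have "card (\<Union>?F) = (\<Sum>C\<in>?F. card C)"
  proof (rule card_Union_disjoint)
    show "disjoint ?F"
      unfolding disjoint_def using orb by blast
    show "finite C" if "C \<in> ?F" for C using that finite_subset by blast
  qed
  ultimately show ?thesis by (simp add: cycle_count_def)
qed

text \<open>
  A cycle of length \<open>v\<close> can be read off from any of its \<open>v\<close> points, and the starting
  point determines the tuple. Counting tuples instead of cycles turns the cycle count into a
  sum over tuples of indicators.
\<close>
lemma card_cyclic_tuples: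
  assumes p: "p permutes {1..n}" and v: "v \<ge> 1"
  shows "card (cyclic_tuples n v p) = v * cycle_count n v p"
proof -
  let ?A = "{a \<in> {1..n}. card (orbit p a) = v}"
  have self: "a \<in> orbit p a" for a
    using p permutation_self_in_orbit permutation_permutes finite_atLeastAtMost by metis
  have step: "x i = (p ^^ i) (x 0)" if "x \<in> cyclic_tuples n v p" "i < v" for x i
    using that(2)
  proof (induction i)
    case (Suc i)
    have "\<forall>i<v. p (x i) = x (Suc i mod v)" using that(1) by (simp add: cyclic_tuples_def)
    then have "p (x i) = x (Suc i mod v)" using Suc.prems by simp
    then have "p (x i) = x (Suc i)" using Suc.prems by simp
    then show ?case using Suc by simp
  qed simp
  have "bij_betw (\<lambda>x. x 0) (cyclic_tuples n v p) ?A"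
  proof (rule bij_betw_imageI)
    show "inj_on (\<lambda>x. x 0) (cyclic_tuples n v p)"
    proof (rule inj_onI)
      fix x y assume x: "x \<in> cyclic_tuples n v p" and y: "y \<in> cyclic_tuples n v p" and e: "x 0 = y 0"
      show "x = y"
      proof (rule PiE_ext)
        show "x \<in> {..<v} \<rightarrow>\<^sub>E {1..n}" "y \<in> {..<v} \<rightarrow>\<^sub>E {1..n}"
          using x y by (auto simp: cyclic_tuples_def)
        show "x i = y i" if "i \<in> {..<v}" for i
          using step[OF x, of i] step[OF y, of i] e that by simp
      qed
    qed
    show "(\<lambda>x. x 0) ` cyclic_tuples n v p = ?A"
    proof (intro set_eqI iffI)
      fix a assume "a \<in> (\<lambda>x. x 0) ` cyclic_tuples n v p"
      then obtain x where x: "x \<in> cyclic_tuples n v p" and a: "a = x 0" by blast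
      have P: "p (x i) = x (Suc i mod v)" if "i < v" for i
        using x that by (auto simp: cyclic_tuples_def)
      have "orbit p a = x ` {..<v}"
      proof (intro equalityI subsetI)
        fix b assume "b \<in> orbit p a"
        then show "b \<in> x ` {..<v}"
        proof induction
          case base
          then show ?case using P[of 0] a v by auto
        next
          case (step c)
          then show ?case using P v by auto
        qed
      next
        fix b assume "b \<in> x ` {..<v}"
        then obtain i where i: "i < v" "b = x i" by blast
        then have "b = (p ^^ i) a" using step[OF x i(1)] a by simp
        then show "b \<in> orbit p a" using self[of a] by (simp add: funpow_in_orbit)
      qed
      moreover have "card (x ` {..<v}) = v" using x by (simp add: cyclic_tuples_def card_image)
      moreover have "a \<in> {1..n}" using x a v by (auto simp: cyclic_tuples_def PiE_def Pi_def)
      ultimately show "a \<in> ?A" by simp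
    next
      fix a assume a: "a \<in> ?A"
      let ?d = "funpow_dist1 p a a"
      have inj: "inj_on (\<lambda>i. (p ^^ i) a) {0..<?d}"
        using inj_on_funpow_dist1[OF self] .
      have "card (orbit p a) = ?d"
        using orbit_conv_funpow_dist1[OF self] inj by (metis card_image card_atLeastLessThan diff_zero)
      then have d: "?d = v" using a by simp
      then have ret: "(p ^^ v) a = a" using funpow_dist1_prop[OF self[of a]] by simp
      define x where "x = (\<lambda>i\<in>{..<v}. (p ^^ i) a)"
      have "(p ^^ i) a \<in> {1..n}" for i
        using permutes_orbit_subset[OF p, of a] a funpow_in_orbit[OF self] by blast
      moreover have "p (x i) = x (Suc i mod v)" if "i < v" for i
        using that ret v by (cases "Suc i = v") (auto simp: x_def)
      ultimately have "x \<in> cyclic_tuples n v p"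
        using inj unfolding d cyclic_tuples_def
        by (auto simp: x_def inj_on_def simp flip: atLeast0LessThan)
      moreover have "x 0 = a" using v by (simp add: x_def)
      ultimately show "a \<in> (\<lambda>x. x 0) ` cyclic_tuples n v p" by blast
    qed
  qed
  then have "card (cyclic_tuples n v p) = card ?A" by (rule bij_betw_same_card)
  then show ?thesis using card_points_in_cycles[OF p] by simp
qed

text \<open>
  \<open>q\<close> carries the cycles of \<open>p \<circ> q\<close> to those of \<open>q \<circ> p\<close>. This makes the roles of the two
  permutations interchangeable, so that it does not matter which one is conjugation invariant.
\<close>
lemma cycle_count_comp_commute:
  assumes p: "p permutes {1..n}" and q: "q permutes {1..n}" and v: "v \<ge> 1"
  shows "cycle_count n v (p \<circ> q) = cycle_count n v (q \<circ> p)"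
proof -
  have le: "card (cyclic_tuples n v (p \<circ> q)) \<le> card (cyclic_tuples n v (q \<circ> p))"
    if p: "p permutes {1..n}" and q: "q permutes {1..n}" for p q
  proof (rule card_inj_on_le)
    let ?f = "\<lambda>x. \<lambda>i\<in>{..<v}. q (x i)"
    have injq: "inj q" using q permutes_inj by blast
    show "inj_on ?f (cyclic_tuples n v (p \<circ> q))"
    proof (rule inj_onI)
      fix x y assume x: "x \<in> cyclic_tuples n v (p \<circ> q)" and y: "y \<in> cyclic_tuples n v (p \<circ> q)"
        and e: "?f x = ?f y"
      show "x = y"
      proof (rule PiE_ext)
        show "x \<in> {..<v} \<rightarrow>\<^sub>E {1..n}" "y \<in> {..<v} \<rightarrow>\<^sub>E {1..n}"
          using x y by (auto simp: cyclic_tuples_def)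
        show "x i = y i" if "i \<in> {..<v}" for i
          using fun_cong[OF e, of i] that injq by (auto dest: injD)
      qed
    qed
    show "?f ` cyclic_tuples n v (p \<circ> q) \<subseteq> cyclic_tuples n v (q \<circ> p)"
    proof (rule image_subsetI)
      fix x assume x: "x \<in> cyclic_tuples n v (p \<circ> q)"
      have "q (x i) \<in> {1..n}" if "i < v" for i
        using x that permutes_in_image[OF q] by (auto simp: cyclic_tuples_def PiE_def Pi_def)
      moreover have "inj_on (?f x) {..<v}"
        using x injq by (auto simp: cyclic_tuples_def inj_on_def dest: injD)
      ultimately show "?f x \<in> cyclic_tuples n v (q \<circ> p)"
        using x by (auto simp: cyclic_tuples_def)
    qed
    show "finite (cyclic_tuples n v (q \<circ> p))"
      by (rule finite_subset[of _ "{..<v} \<rightarrow>\<^sub>E {1..n}"])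
        (auto simp: cyclic_tuples_def intro!: finite_PiE)
  qed
  have "v * cycle_count n v (p \<circ> q) = v * cycle_count n v (q \<circ> p)"
    using le[OF p q] le[OF q p] card_cyclic_tuples[OF permutes_compose v] p q
    by (metis le_antisym)
  then show ?thesis using v by simp
qed

section \<open>Maps that follow prescribed edges\<close>

definition component_rel :: "'a set \<Rightarrow> ('a \<times> 'a) set \<Rightarrow> ('a \<times> 'a) set" where
  "component_rel D E = (E \<union> E\<inverse>)\<^sup>* \<inter> D \<times> D"

text \<open>
  The maps may fail to be injective: they only serve for upper bounds.
\<close>
definition edge_maps :: "nat \<Rightarrow> 'a set \<Rightarrow> ('a \<times> 'a) set \<Rightarrow> (nat \<Rightarrow> nat) \<Rightarrow> ('a \<Rightarrow> nat) set" where
  "edge_maps n D E p = {g \<in> D \<rightarrow>\<^sub>E {1..n}. \<forall>(a, b)\<in>E. p (g a) = g b}"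

lemma equiv_component_rel: "equiv D (component_rel D E)"
proof (rule equivI)
  show "sym (component_rel D E)"
    unfolding component_rel_def
    by (intro sym_Int sym_rtrancl sym_Un_converse) (auto intro: symI)
  show "trans (component_rel D E)"
    unfolding component_rel_def by (intro trans_Int trans_rtrancl) (auto intro: transI)
qed (auto simp: component_rel_def refl_on_def)

lemma edge_maps_eq_on_component:
  assumes p: "inj p" and g: "\<forall>(a, b)\<in>E. p (g a) = g b" and h: "\<forall>(a, b)\<in>E. p (h a) = h b"
    and ab: "(a, b) \<in> (E \<union> E\<inverse>)\<^sup>*" and eq: "g a = h a"
  shows "g b = h b"
  using ab
proof (induction rule: rtrancl_induct)
  case (step c d)
  show ?case
  proof (cases "(c, d) \<in> E")
    case True
    then show ?thesis using g h step.IH by fastforce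
  next
    case False
    then have "(d, c) \<in> E" using step.hyps by auto
    then have "p (g d) = p (h d)" using g h step.IH by fastforce
    then show ?thesis using p by (auto dest: injD)
  qed
qed (rule eq)

text \<open>
  A map is determined by one value in each component of the edge graph, and a component with a
  single vertex carries a loop, so its value is a fixed point of \<open>p\<close>. Giving every vertex the
  weight \<open>sqrt n\<close>, a component of two vertices is worth exactly the \<open>n\<close> choices for its value;
  every other size falls short by a factor \<open>y\<close>: at most \<open>sqrt n * y\<close> fixed points for one
  vertex, and \<open>n \<le> sqrt n ^ k * y\<close> for \<open>k \<ge> 3\<close> vertices. Thus all patterns are of order at
  most \<open>sqrt n ^ card D\<close>, and only those made of two-vertex components reach this order.
\<close>
lemma card_edge_maps_le:
  fixes y :: real
  assumes p: "inj p" and D: "finite D" and E: "E \<subseteq> D \<times> D" and inc: "D \<subseteq> Field E"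
    and n: "n \<ge> 1" and fp: "real (card {i \<in> {1..n}. p i = i}) \<le> sqrt n * y"
    and y: "1 / sqrt n \<le> y"
  shows "real (card (edge_maps n D E p)) \<le>
    sqrt n ^ card D * (\<Prod>C\<in>D // component_rel D E. if card C = 2 then 1 else y)"
proof -
  let ?Q = "D // component_rel D E"
  let ?fix = "{i \<in> {1..n}. p i = i}"
  let ?T = "\<lambda>C. if card C = 1 then ?fix else {1..n}"
  note eqv = equiv_component_rel[of D E]
  have finQ: "finite ?Q" using D by (simp add: component_rel_def finite_quotient)
  have finC: "finite C" if "C \<in> ?Q" for C
    using that D in_quotient_imp_subset[OF eqv] finite_subset by blast
  have neC: "C \<noteq> {}" if "C \<in> ?Q" for C using that in_quotient_imp_non_empty[OF eqv] by blast
  define rep where "rep C = (SOME a. a \<in> C)" for C :: "'a set"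
  have rep: "rep C \<in> C" if "C \<in> ?Q" for C
    using neC[OF that] unfolding rep_def by (auto intro: someI)
  have rel: "(rep C, b) \<in> (E \<union> E\<inverse>)\<^sup>*" if "C \<in> ?Q" "b \<in> C" for C b
    using in_quotient_imp_in_rel[OF eqv that(1)] rep[OF that(1)] that(2)
    by (auto simp: component_rel_def)
  \<comment> \<open>A map that follows the edges is determined by its values at one representative of each component.\<close>
  have "card (edge_maps n D E p) \<le> card (PiE ?Q ?T)"
  proof (rule card_inj_on_le[where f = "\<lambda>g. \<lambda>C\<in>?Q. g (rep C)"])
    show "inj_on (\<lambda>g. \<lambda>C\<in>?Q. g (rep C)) (edge_maps n D E p)"
    proof (rule inj_onI)
      fix g h assume g: "g \<in> edge_maps n D E p" and h: "h \<in> edge_maps n D E p"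
        and e: "(\<lambda>C\<in>?Q. g (rep C)) = (\<lambda>C\<in>?Q. h (rep C))"
      show "g = h"
      proof (rule PiE_ext)
        show "g \<in> D \<rightarrow>\<^sub>E {1..n}" "h \<in> D \<rightarrow>\<^sub>E {1..n}" using g h by (auto simp: edge_maps_def)
        fix b assume "b \<in> D"
        then obtain C where C: "C \<in> ?Q" "b \<in> C" using Union_quotient[OF eqv] by blast
        have "g (rep C) = h (rep C)" using fun_cong[OF e, of C] C by simp
        then show "g b = h b"
          using edge_maps_eq_on_component[OF p _ _ rel[OF C]] g h
          by (auto simp: edge_maps_def)
      qed
    qed
    show "(\<lambda>g. \<lambda>C\<in>?Q. g (rep C)) ` edge_maps n D E p \<subseteq> PiE ?Q ?T"
    proof (intro image_subsetI restrict_PiE_iff[THEN iffD2] ballI)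
      fix g C assume g: "g \<in> edge_maps n D E p" and C: "C \<in> ?Q"
      have CD: "C \<subseteq> D" using in_quotient_imp_subset[OF eqv C] .
      have 1: "g (rep C) \<in> {1..n}"
        using g rep[OF C] CD by (auto simp: edge_maps_def PiE_def Pi_def)
      show "g (rep C) \<in> ?T C"
      proof (cases "card C = 1")
        case True
        then have CC: "C = {rep C}" using rep[OF C] by (metis card_1_singletonE singletonD)
        obtain b where b: "(rep C, b) \<in> E \<or> (b, rep C) \<in> E"
          using inc CD rep[OF C] unfolding Field_def by blast
        then have "(rep C, b) \<in> component_rel D E"
          using E by (auto simp: component_rel_def)
        then have "b \<in> C" using in_quotient_imp_closed[OF eqv C rep[OF C]] by blast
        then have "b = rep C" using CC by blast
        then have "p (g (rep C)) = g (rep C)" using b g by (auto simp: edge_maps_def)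
        then show ?thesis using 1 True by simp
      qed (use 1 in auto)
    qed
    show "finite (PiE ?Q ?T)" using finQ by (intro finite_PiE) auto
  qed
  also have "\<dots> = (\<Prod>C\<in>?Q. card (?T C))" using finQ by (simp add: card_PiE)
  finally have "real (card (edge_maps n D E p)) \<le> (\<Prod>C\<in>?Q. real (card (?T C)))"
    by (simp only: of_nat_prod[symmetric] of_nat_le_iff)
  also have "\<dots> \<le> (\<Prod>C\<in>?Q. sqrt n ^ card C * (if card C = 2 then 1 else y))"
  proof (rule prod_mono, rule conjI)
    fix C assume C: "C \<in> ?Q"
    have s1: "sqrt n \<ge> 1" using n by simp
    have c0: "card C \<noteq> 0" using finC[OF C] neC[OF C] by simp
    consider "card C = 1" | "card C = 2" | "card C \<ge> 3" using c0 by linarith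
    then show "real (card (?T C)) \<le> sqrt n ^ card C * (if card C = 2 then 1 else y)"
    proof cases
      case 3
      have "real n = sqrt n ^ 2" by simp
      also have "\<dots> \<le> sqrt n ^ (card C - 1)" using 3 s1 by (intro power_increasing) auto
      also have "\<dots> = sqrt n ^ card C * (1 / sqrt n)"
        using s1 c0 by (cases "card C") (auto simp: field_simps)
      also have "\<dots> \<le> sqrt n ^ card C * y" using y by (intro mult_left_mono) auto
      finally show ?thesis using 3 by simp
    qed (use fp in auto)
  qed auto
  also have "\<dots> = (\<Prod>C\<in>?Q. sqrt n ^ card C) * (\<Prod>C\<in>?Q. if card C = 2 then 1 else y)"
    by (rule prod.distrib)
  also have "(\<Prod>C\<in>?Q. sqrt n ^ card C) = sqrt n ^ (\<Sum>C\<in>?Q. card C)"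
    by (simp add: power_sum)
  also have "(\<Sum>C\<in>?Q. card C) = card (\<Union>?Q)"
    using quotient_disj[OF eqv] finC
    by (subst card_Union_disjoint) (auto simp: disjoint_def)
  also have "\<Union>?Q = D" using Union_quotient[OF eqv] .
  finally show ?thesis .
qed

lemma card_edge_maps_le_simple:
  fixes y :: real
  assumes p: "inj p" and D: "finite D" and E: "E \<subseteq> D \<times> D" and inc: "D \<subseteq> Field E"
    and n: "n \<ge> 1" and fp: "real (card {i \<in> {1..n}. p i = i}) \<le> sqrt n * y"
    and y: "1 / sqrt n \<le> y"
  shows "real (card (edge_maps n D E p)) \<le> sqrt n ^ card D * (1 + y) ^ card D"
    and "\<lbrakk>C \<in> D // component_rel D E; card C \<noteq> 2\<rbrakk> \<Longrightarrow>
      real (card (edge_maps n D E p)) \<le> sqrt n ^ card D * (y * (1 + y) ^ card D)"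
proof -
  let ?Q = "D // component_rel D E"
  let ?u = "\<lambda>C::'a set. if card C = 2 then 1 else y"
  have y0: "y \<ge> 0" by (rule order_trans[OF _ y]) simp
  have finQ: "finite ?Q" using D by (simp add: component_rel_def finite_quotient)
  have cQ: "card ?Q \<le> card D"
    unfolding quotient_def by (rule order_trans[OF card_UN_le[OF D]]) simp
  have le: "(\<Prod>C\<in>B. ?u C) \<le> (1 + y) ^ card D" if "B \<subseteq> ?Q" for B
  proof -
    have "(\<Prod>C\<in>B. ?u C) \<le> (\<Prod>C\<in>B. 1 + y)" using y0 by (intro prod_mono) auto
    also have "\<dots> = (1 + y) ^ card B" by simp
    also have "\<dots> \<le> (1 + y) ^ card D"
      using y0 cQ card_mono[OF finQ that] by (intro power_increasing) auto
    finally show ?thesis .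
  qed
  note main = card_edge_maps_le[OF assms]
  show "real (card (edge_maps n D E p)) \<le> sqrt n ^ card D * (1 + y) ^ card D"
    using main le[of ?Q] by (smt (verit) mult_left_mono order_refl real_sqrt_ge_zero of_nat_0_le_iff zero_le_power)
  show "real (card (edge_maps n D E p)) \<le> sqrt n ^ card D * (y * (1 + y) ^ card D)"
    if C: "C \<in> ?Q" "card C \<noteq> 2"
  proof -
    have "(\<Prod>C\<in>?Q. ?u C) = y * (\<Prod>C\<in>?Q - {C}. ?u C)"
      using C finQ by (subst prod.remove[of _ C]) auto
    also have "\<dots> \<le> y * (1 + y) ^ card D" using y0 le[of "?Q - {C}"] by (intro mult_left_mono) auto
    finally show ?thesis
      using main by (smt (verit) mult_left_mono order_refl real_sqrt_ge_zero of_nat_0_le_iff zero_le_power)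
  qed
qed

text \<open>
  When every vertex has at most one outgoing and one incoming edge, a looped vertex has used up
  both, so nothing else can be attached to it.
\<close>
lemma component_of_loop:
  assumes sv: "single_valued E" and sv': "single_valued (E\<inverse>)" and aa: "(a, a) \<in> E"
    and b: "(a, b) \<in> (E \<union> E\<inverse>)\<^sup>*"
  shows "b = a"
  using b
proof (induction rule: rtrancl_induct)
  case (step c d)
  then show ?case using sv sv' aa by (auto simp: single_valued_def)
qed simp

text \<open>
  In a component of two vertices there is no loop, and a path of two edges must return to its
  start because a third vertex would not fit.
\<close>
lemma two_point_components:
  assumes sv: "single_valued E" and sv': "single_valued (E\<inverse>)" and E: "E \<subseteq> D \<times> D"
    and two: "\<forall>C\<in>D // component_rel D E. card C = 2"
    and ab: "(a, b) \<in> E"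
  shows "a \<noteq> b" and "(b, c) \<in> E \<Longrightarrow> c = a"
proof -
  let ?C = "component_rel D E `` {b}"
  have C: "?C \<in> D // component_rel D E" using ab E by (auto intro: quotientI)
  have no_loop: False if "(d, d) \<in> E" for d
  proof -
    have "component_rel D E `` {d} = {d}"
      using component_of_loop[OF sv sv' that] that E by (auto simp: component_rel_def)
    moreover have "component_rel D E `` {d} \<in> D // component_rel D E"
      using that E by (auto intro: quotientI)
    ultimately show False using two by fastforce
  qed
  show "a \<noteq> b" using ab no_loop by blast
  show "c = a" if bc: "(b, c) \<in> E"
  proof (rule ccontr)
    assume "c \<noteq> a"
    moreover have "a \<noteq> b" "b \<noteq> c" using ab bc no_loop by blast+
    ultimately have "card {a, b, c} = 3" by simp
    moreover have "{a, b, c} \<subseteq> ?C" using ab bc E by (auto simp: component_rel_def)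
    moreover have "finite ?C" using two C by (intro card_ge_0_finite) simp
    ultimately have "3 \<le> card ?C" using card_mono[of ?C "{a, b, c}"] by presburger
    then show False using two C by simp
  qed
qed

lemma Suc_mod_inj: "Suc i mod v = Suc j mod v \<Longrightarrow> i < v \<Longrightarrow> j < v \<Longrightarrow> i = j"
  by (cases "Suc i = v"; cases "Suc j = v") auto

text \<open>
  This is the combinatorial reason why only generic tuples survive in the limit. In the
  application \<open>y i\<close> is the image of \<open>x i\<close> under the second permutation; the edges
  \<open>x i \<rightarrow> y i\<close> and \<open>y i \<rightarrow> x (i + 1)\<close> are those of the two factors. If \<open>x i = y j\<close>, then in
  two-vertex components the first kind of edges gives \<open>x j = y i\<close>, and then the second kind gives
  \<open>x (i + 1) = y (j - 1)\<close>. So the coincidence propagates inwards, as a reflection of the cycle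
  \<open>x 0, y 0, x 1, y 1, \<dots>\<close>, until it reaches \<open>x k = y k\<close> or \<open>x (k + 1) = y k\<close>, that is, a loop.
\<close>
lemma two_point_components_disjoint:
  fixes x y :: "nat \<Rightarrow> 'a"
  assumes x: "inj_on x {..<v}" and y: "inj_on y {..<v}"
    and D: "D = x ` {..<v} \<union> y ` {..<v}"
    and two1: "\<forall>C\<in>D // component_rel D {(x i, y i) |i. i < v}. card C = 2"
    and two2: "\<forall>C\<in>D // component_rel D {(y i, x (Suc i mod v)) |i. i < v}. card C = 2"
    and ij: "i < v" "j < v"
  shows "x i \<noteq> y j"
proof -
  let ?E1 = "{(x i, y i) |i. i < v}" and ?E2 = "{(y i, x (Suc i mod v)) |i. i < v}"
  have 1: "single_valued ?E1" "single_valued (?E1\<inverse>)" "?E1 \<subseteq> D \<times> D"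
    using x y D by (auto simp: single_valued_def inj_on_def)
  have "single_valued ?E2" using y by (auto simp: single_valued_def inj_on_def)
  moreover have "single_valued (?E2\<inverse>)"
  proof -
    have "i = j" if "x (Suc i mod v) = x (Suc j mod v)" "i < v" "j < v" for i j
      using that x Suc_mod_inj[of i v j] by (auto simp: inj_on_def)
    then show ?thesis by (fastforce simp: single_valued_def)
  qed
  moreover have "?E2 \<subseteq> D \<times> D" using D by auto
  ultimately have 2: "single_valued ?E2" "single_valued (?E2\<inverse>)" "?E2 \<subseteq> D \<times> D" .
  have A: "x i \<noteq> y i" if "i < v" for i
    by (rule two_point_components(1)[OF 1 two1]) (use that in auto)
  have B: "x i = y j" if "x j = y i" "i < v" "j < v" for i j
  proof -
    have "(x i, y i) \<in> ?E1" using that by blast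
    moreover have "(y i, y j) \<in> ?E1" unfolding that(1)[symmetric] using that by blast
    ultimately have "y j = x i" by (rule two_point_components(2)[OF 1 two1])
    then show ?thesis by simp
  qed
  have A': "y i \<noteq> x (Suc i)" if "Suc i < v" for i
  proof -
    have "(y i, x (Suc i)) \<in> ?E2" using that by (auto intro!: exI[of _ i])
    then show ?thesis by (rule two_point_components(1)[OF 2 two2])
  qed
  have B': "x (Suc i) = y j" if "y i = x (Suc j)" "Suc i < v" "Suc j < v" for i j
  proof -
    have "(y i, x (Suc i)) \<in> ?E2" using that by (auto intro!: exI[of _ i])
    moreover have "(y j, y i) \<in> ?E2" unfolding that(1) using that by (auto intro!: exI[of _ j])
    ultimately show ?thesis by (intro two_point_components(2)[OF 2 two2])
  qed
  \<comment> \<open>By symmetry \<open>i \<le> j\<close> may be assumed, so that propagating inwards never wraps around the end of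
    the tuple.\<close>
  have le: "x i \<noteq> y j" if "i \<le> j" "j < v" for i j
    using that
  proof (induction "j - i" arbitrary: i j rule: less_induct)
    case less
    show ?case
    proof
      assume e: "x i = y j"
      have e': "x j = y i" using B[OF e] less.prems by auto
      consider "j = i" | "j = Suc i" | "j \<ge> Suc (Suc i)" using less.prems by linarith
      then show False
      proof cases
        case 1 then show False using e A less.prems by auto
      next
        case 2 then show False using e' A'[of i] less.prems by auto
      next
        case 3
        then obtain k where k: "j = Suc k" "Suc i \<le> k" by (cases j) auto
        have "x (Suc i) = y k" using B'[of i k] e' k less.prems by auto
        then show False using less.hyps[of k "Suc i"] k less.prems by auto
      qed
    qed
  qed
  show ?thesis
  proof (cases "i \<le> j")
    case False
    then have "x j \<noteq> y i" using le[of j i] ij by auto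
    then show ?thesis using B[of i j] ij by auto
  qed (use le ij in auto)
qed

section \<open>Conjugators that close a tuple into a cycle\<close>

definition injective_tuples :: "nat \<Rightarrow> nat \<Rightarrow> (nat \<Rightarrow> nat) set" where
  "injective_tuples n v = {x \<in> {..<v} \<rightarrow>\<^sub>E {1..n}. inj_on x {..<v}}"

text \<open>
  For an injective tuple \<open>x\<close> and an injective \<open>p\<close>, these pairs describe all equalities among
  the entries of \<open>x\<close> and their images, hence the complete pattern of the tuple.
\<close>
definition coincidences :: "nat \<Rightarrow> (nat \<Rightarrow> nat) \<Rightarrow> (nat \<Rightarrow> nat) \<Rightarrow> (nat \<times> nat) set" where
  "coincidences v p x = {(i, j). i < v \<and> j < v \<and> x i = p (x j)}"

definition generic_tuples :: "nat \<Rightarrow> nat \<Rightarrow> (nat \<Rightarrow> nat) \<Rightarrow> (nat \<Rightarrow> nat) set" where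
  "generic_tuples n v p = {x \<in> injective_tuples n v. coincidences v p x = {}}"

text \<open>
  These are the \<open>\<tau>\<close> for which \<open>x\<close> is a cyclic tuple of \<open>inv \<tau> \<circ> s \<circ> \<tau> \<circ> r\<close>, up to the
  injectivity of \<open>x\<close>.
\<close>
definition closing_perms ::
  "nat \<Rightarrow> nat \<Rightarrow> (nat \<Rightarrow> nat) \<Rightarrow> (nat \<Rightarrow> nat) \<Rightarrow> (nat \<Rightarrow> nat) \<Rightarrow> (nat \<Rightarrow> nat) set" where
  "closing_perms n v s r x =
    {\<tau>. \<tau> permutes {1..n} \<and> (\<forall>i<v. s (\<tau> (r (x i))) = \<tau> (x (Suc i mod v)))}"

lemma finite_injective_tuples [simp]: "finite (injective_tuples n v)"
  by (rule finite_subset[of _ "{..<v} \<rightarrow>\<^sub>E {1..n}"])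
    (auto simp: injective_tuples_def intro!: finite_PiE)

lemma injective_tuples_range: "x \<in> injective_tuples n v \<Longrightarrow> i < v \<Longrightarrow> x i \<in> {1..n}"
  by (auto simp: injective_tuples_def PiE_def Pi_def)

text \<open>
  One extension \<open>\<theta>\<close> exists because the complements of domain and range have equal size; all
  others arise from it by permuting the complement of the domain first.
\<close>
lemma card_permutes_extending:
  assumes J: "finite J" and a: "inj_on a J" and b: "inj_on b J"
    and aS: "a ` J \<subseteq> {1..n}" and bS: "b ` J \<subseteq> {1..n}"
  shows "card {\<tau>. \<tau> permutes {1..n} \<and> (\<forall>j\<in>J. \<tau> (a j) = b j)} = fact (n - card J)"
proof -
  let ?S = "{1..n}"
  have "card (?S - a ` J) = card (?S - b ` J)"
    using a b aS bS J by (simp add: card_Diff_subset card_image)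
  then obtain h where h: "bij_betw h (?S - a ` J) (?S - b ` J)"
    using finite_same_card_bij[of "?S - a ` J" "?S - b ` J"] by auto
  define \<theta> where "\<theta> k = (if k \<in> a ` J then b (inv_into J a k) else if k \<in> ?S then h k else k)" for k
  have \<theta>a: "\<theta> (a j) = b j" if "j \<in> J" for j
    using that a by (simp add: \<theta>_def)
  have "bij_betw \<theta> (a ` J) (b ` J)"
    using a b \<theta>a by (intro bij_betw_imageI) (auto simp: inj_on_def image_image)
  moreover have "bij_betw \<theta> (?S - a ` J) (?S - b ` J)"
    using h by (rule bij_betw_cong[THEN iffD1, rotated]) (auto simp: \<theta>_def)
  ultimately have "bij_betw \<theta> (a ` J \<union> (?S - a ` J)) (b ` J \<union> (?S - b ` J))"
    by (rule bij_betw_combine) auto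
  then have "bij_betw \<theta> ?S ?S"
    using aS bS by (simp add: Un_absorb1)
  then have \<theta>: "\<theta> permutes ?S"
    using aS by (intro bij_imp_permutes) (auto simp: \<theta>_def)
  have "bij_betw (\<lambda>p. \<theta> \<circ> p) {p. p permutes ?S - a ` J}
      {\<tau>. \<tau> permutes ?S \<and> (\<forall>j\<in>J. \<tau> (a j) = b j)}"
  proof (rule bij_betw_imageI)
    show "inj_on (\<lambda>p. \<theta> \<circ> p) {p. p permutes ?S - a ` J}"
      using permutes_inj[OF \<theta>] by (auto simp: inj_on_def fun_eq_iff)
    show "(\<lambda>p. \<theta> \<circ> p) ` {p. p permutes ?S - a ` J} =
      {\<tau>. \<tau> permutes ?S \<and> (\<forall>j\<in>J. \<tau> (a j) = b j)}"
    proof (intro set_eqI iffI)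
      fix \<tau> assume "\<tau> \<in> (\<lambda>p. \<theta> \<circ> p) ` {p. p permutes ?S - a ` J}"
      then obtain p where p: "p permutes ?S - a ` J" and t: "\<tau> = \<theta> \<circ> p" by blast
      have "p permutes ?S" using p by (rule permutes_subset) auto
      moreover have "p (a j) = a j" if "j \<in> J" for j using p that by (auto simp: permutes_def)
      ultimately show "\<tau> \<in> {\<tau>. \<tau> permutes ?S \<and> (\<forall>j\<in>J. \<tau> (a j) = b j)}"
        using \<theta> \<theta>a t by (auto intro: permutes_compose)
    next
      fix \<tau> assume "\<tau> \<in> {\<tau>. \<tau> permutes ?S \<and> (\<forall>j\<in>J. \<tau> (a j) = b j)}"
      then have t: "\<tau> permutes ?S" and tb: "\<And>j. j \<in> J \<Longrightarrow> \<tau> (a j) = b j" by auto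
      let ?p = "inv \<theta> \<circ> \<tau>"
      \<comment> \<open>On \<open>a ` J\<close> both \<open>\<tau>\<close> and \<open>\<theta>\<close> agree, so their quotient moves only the complement.\<close>
      have "?p permutes ?S" using t \<theta> by (intro permutes_compose permutes_inv)
      moreover have "?p k = k" if k: "k \<in> ?S - (?S - a ` J)" for k
      proof -
        obtain j where j: "j \<in> J" "k = a j" using k by auto
        then have "\<tau> k = \<theta> k" using tb \<theta>a by simp
        then show ?thesis using permutes_inverses(2)[OF \<theta>] by simp
      qed
      ultimately have "?p permutes ?S - a ` J" by (rule permutes_superset)
      moreover have "\<tau> = \<theta> \<circ> ?p" using permutes_inverses(1)[OF \<theta>] by (simp add: fun_eq_iff)
      ultimately show "\<tau> \<in> (\<lambda>p. \<theta> \<circ> p) ` {p. p permutes ?S - a ` J}" by blast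
    qed
  qed
  then have "card {\<tau>. \<tau> permutes ?S \<and> (\<forall>j\<in>J. \<tau> (a j) = b j)} = card {p. p permutes ?S - a ` J}"
    by (rule bij_betw_same_card[symmetric])
  also have "\<dots> = fact (card (?S - a ` J))"
    by (rule card_permutations) auto
  also have "card (?S - a ` J) = n - card J"
    using a aS J by (simp add: card_Diff_subset card_image)
  finally show ?thesis .
qed

text \<open>
  Double counting of the pairs of a conjugator \<open>\<tau>\<close> and a tuple that is cyclic for the
  conjugated product.
\<close>
lemma sum_card_cyclic_tuples_conj:
  "(\<Sum>\<tau> | \<tau> permutes {1..n}. card (cyclic_tuples n v (inv \<tau> \<circ> s \<circ> \<tau> \<circ> r))) =
    (\<Sum>x\<in>injective_tuples n v. card (closing_perms n v s r x))"
proof -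
  let ?P = "{\<tau>. \<tau> permutes {1..n}}" and ?X = "injective_tuples n v"
  have finP: "finite ?P" by (simp add: finite_permutations)
  let ?R = "\<lambda>\<tau> x. \<forall>i<v. s (\<tau> (r (x i))) = \<tau> (x (Suc i mod v))"
  have 1: "cyclic_tuples n v (inv \<tau> \<circ> s \<circ> \<tau> \<circ> r) = {x \<in> ?X. ?R \<tau> x}" if "\<tau> permutes {1..n}" for \<tau>
    using permutes_inverses[OF that]
    unfolding cyclic_tuples_def injective_tuples_def by (auto simp: permutes_inv_eq[OF that])
  have 2: "closing_perms n v s r x = {\<tau> \<in> ?P. ?R \<tau> x}" for x
    by (auto simp: closing_perms_def)
  have count: "card {a \<in> A. Q a} = (\<Sum>a\<in>A. of_bool (Q a))" if "finite A" for A :: "'b set" and Q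
    using that by (simp add: Collect_conj_eq)
  have "(\<Sum>\<tau>\<in>?P. card {x \<in> ?X. ?R \<tau> x}) = (\<Sum>x\<in>?X. card {\<tau> \<in> ?P. ?R \<tau> x})"
    unfolding count[OF finP] count[OF finite_injective_tuples] by (rule sum.swap)
  then show ?thesis using 1 2 by simp
qed

text \<open>
  If \<open>x\<close> is generic for \<open>r\<close>, then a closing \<open>\<tau>\<close> sends the points \<open>r (x i)\<close> to a tuple \<open>z\<close>
  that is generic for \<open>s\<close>, and sends \<open>x (i + 1)\<close> to \<open>s (z i)\<close>. Conversely each generic \<open>z\<close>
  prescribes \<open>\<tau>\<close> on \<open>2 * v\<close> distinct points with distinct values.
\<close>
lemma card_closing_perms_generic:
  assumes s: "s permutes {1..n}" and r: "r permutes {1..n}" and x: "x \<in> generic_tuples n v r"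
  shows "card (closing_perms n v s r x) = card (generic_tuples n v s) * fact (n - 2 * v)"
proof -
  have inj_s: "inj s" and inj_r: "inj r" using s r permutes_inj by blast+
  have xX: "x \<in> injective_tuples n v" and xg: "\<And>i j. i < v \<Longrightarrow> j < v \<Longrightarrow> x i \<noteq> r (x j)"
    using x by (auto simp: generic_tuples_def coincidences_def)
  have xinj: "inj_on x {..<v}" using xX by (simp add: injective_tuples_def)
  let ?J = "(UNIV :: bool set) \<times> {..<v}"
  \<comment> \<open>The tag \<open>e\<close> separates the \<open>v\<close> points \<open>x (i + 1)\<close> from the \<open>v\<close> points \<open>r (x i)\<close>.\<close>
  define a where "a = (\<lambda>(e, i). if e then x (Suc i mod v) else r (x i))"
  define b where "b z = (\<lambda>(e, i). if e then s (z i) else z i)" for z :: "nat \<Rightarrow> nat"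
  define Z where "Z z = {\<tau>. \<tau> permutes {1..n} \<and> (\<forall>j\<in>?J. \<tau> (a j) = b z j)}" for z
  have ainj: "inj_on a ?J"
  proof (rule inj_onI)
    fix p q assume p: "p \<in> ?J" and q: "q \<in> ?J" and e: "a p = a q"
    obtain f i g j where [simp]: "p = (f, i)" "q = (g, j)" by fastforce
    have ij: "i < v" "j < v" using p q by auto
    then have m: "Suc i mod v < v" "Suc j mod v < v" by auto
    show "p = q"
      using e ij m xg[of "Suc i mod v" j] xg[of "Suc j mod v" i] Suc_mod_inj[of i v j] injD[OF inj_r, of "x i" "x j"]
        inj_onD[OF xinj, of i j] inj_onD[OF xinj, of "Suc i mod v" "Suc j mod v"]
      by (cases f; cases g) (auto simp: a_def)
  qed
  have arange: "a ` ?J \<subseteq> {1..n}"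
    using injective_tuples_range[OF xX] permutes_in_image[OF r] by (auto simp: a_def split: if_splits)
  have Zcard: "card (Z z) = fact (n - 2 * v)" if z: "z \<in> generic_tuples n v s" for z
  proof -
    have zX: "z \<in> injective_tuples n v" and zg: "\<And>i j. i < v \<Longrightarrow> j < v \<Longrightarrow> z i \<noteq> s (z j)"
      using z by (auto simp: generic_tuples_def coincidences_def)
    have zinj: "inj_on z {..<v}" using zX by (simp add: injective_tuples_def)
    have "inj_on (b z) ?J"
    proof (rule inj_onI)
      fix p q assume p: "p \<in> ?J" and q: "q \<in> ?J" and e: "b z p = b z q"
      obtain f i g j where [simp]: "p = (f, i)" "q = (g, j)" by fastforce
      have ij: "i < v" "j < v" using p q by auto
      show "p = q"
        using e ij zg[of i j] zg[of j i] injD[OF inj_s, of "z i" "z j"] inj_onD[OF zinj, of i j]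
        by (cases f; cases g) (auto simp: b_def)
    qed
    moreover have "b z ` ?J \<subseteq> {1..n}"
      using injective_tuples_range[OF zX] permutes_in_image[OF s] by (auto simp: b_def split: if_splits)
    ultimately have "card (Z z) = fact (n - card ?J)"
      unfolding Z_def using ainj arange by (intro card_permutes_extending) auto
    then show ?thesis by (simp add: card_cartesian_product)
  qed
  have ball_J: "(\<forall>j\<in>?J. P j) \<longleftrightarrow> (\<forall>i<v. P (True, i) \<and> P (False, i))" for P
    by (auto simp: all_bool_eq)
  have Zalt: "\<tau> \<in> Z z \<longleftrightarrow> \<tau> permutes {1..n} \<and>
      (\<forall>i<v. \<tau> (x (Suc i mod v)) = s (z i) \<and> \<tau> (r (x i)) = z i)" for \<tau> z
    unfolding Z_def ball_J by (simp add: a_def b_def)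
  have "closing_perms n v s r x = (\<Union>z\<in>generic_tuples n v s. Z z)"
  proof (intro set_eqI iffI)
    fix \<tau> assume t: "\<tau> \<in> closing_perms n v s r x"
    then have tp: "\<tau> permutes {1..n}"
      and te: "\<And>i. i < v \<Longrightarrow> s (\<tau> (r (x i))) = \<tau> (x (Suc i mod v))"
      by (auto simp: closing_perms_def)
    have inj_t: "inj \<tau>" using tp permutes_inj by blast
    define z where "z = (\<lambda>i\<in>{..<v}. \<tau> (r (x i)))"
    have "\<tau> (r (x i)) \<in> {1..n}" if "i < v" for i
      by (simp only: permutes_in_image[OF tp] permutes_in_image[OF r] injective_tuples_range[OF xX that])
    moreover have "inj_on z {..<v}"
    proof (rule inj_onI)
      fix i j assume ij: "i \<in> {..<v}" "j \<in> {..<v}" and "z i = z j"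
      then have "x i = x j" by (simp add: z_def inj_eq[OF inj_t] inj_eq[OF inj_r])
      then show "i = j" using inj_onD[OF xinj _ ij] by simp
    qed
    moreover have "z i \<noteq> s (z j)" if "i < v" "j < v" for i j
    proof -
      have m: "Suc j mod v < v" using that by auto
      have "r (x i) \<noteq> x (Suc j mod v)" using xg[OF m that(1)] by auto
      then show ?thesis using te[OF that(2)] that by (simp add: z_def inj_eq[OF inj_t])
    qed
    ultimately have "z \<in> generic_tuples n v s"
      by (auto simp: generic_tuples_def injective_tuples_def coincidences_def z_def)
    moreover have "\<tau> \<in> Z z" unfolding Zalt using tp te by (auto simp: z_def)
    ultimately show "\<tau> \<in> (\<Union>z\<in>generic_tuples n v s. Z z)" by blast
  next
    fix \<tau> assume "\<tau> \<in> (\<Union>z\<in>generic_tuples n v s. Z z)"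
    then show "\<tau> \<in> closing_perms n v s r x" by (auto simp: Zalt closing_perms_def)
  qed
  moreover have "card (\<Union>z\<in>generic_tuples n v s. Z z) = (\<Sum>z\<in>generic_tuples n v s. card (Z z))"
  proof (rule card_UN_disjoint)
    show "finite (generic_tuples n v s)" by (simp add: generic_tuples_def)
    show "\<forall>z\<in>generic_tuples n v s. finite (Z z)"
      unfolding Z_def by (auto intro: finite_subset[OF _ finite_permutations[of "{1..n}"]])
    show "\<forall>z\<in>generic_tuples n v s. \<forall>w\<in>generic_tuples n v s. z \<noteq> w \<longrightarrow> Z z \<inter> Z w = {}"
    proof (intro ballI impI, rule ccontr)
      fix z w assume z: "z \<in> generic_tuples n v s" and w: "w \<in> generic_tuples n v s"
        and ne: "z \<noteq> w" and "Z z \<inter> Z w \<noteq> {}"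
      then obtain \<tau> where "\<tau> \<in> Z z" "\<tau> \<in> Z w" by blast
      then have "z i = w i" if "i < v" for i using that by (auto simp: Zalt)
      then have "z = w"
        using z w by (intro PiE_ext[of z "{..<v}" "\<lambda>_. {1..n}"])
          (auto simp: generic_tuples_def injective_tuples_def)
      then show False using ne by simp
    qed
  qed
  ultimately show ?thesis using Zcard by simp
qed

text \<open>
  The restriction of a closing permutation to the support \<open>D\<close> of the pattern follows the edges
  of the first factor, and a map on \<open>D\<close> has at most \<open>fact (n - card D)\<close> extensions to a
  permutation.
\<close>
lemma card_closing_perms_le:
  assumes s: "s permutes {1..n}" and r: "r permutes {1..n}" and x: "x \<in> injective_tuples n v"
    and D: "D = x ` {..<v} \<union> (\<lambda>i. r (x i)) ` {..<v}"
  shows "card (closing_perms n v s r x) \<le>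
    card (edge_maps n D {(r (x i), x (Suc i mod v)) |i. i < v} s) * fact (n - card D)"
proof -
  let ?E = "{(r (x i), x (Suc i mod v)) |i. i < v}"
  let ?G = "edge_maps n D ?E s"
  let ?T = "\<lambda>g. {\<tau>. \<tau> permutes {1..n} \<and> (\<forall>d\<in>D. \<tau> (id d) = g d)}"
  have finD: "finite D" and DS: "D \<subseteq> {1..n}"
    using injective_tuples_range[OF x] permutes_in_image[OF r] by (auto simp: D)
  have finG: "finite ?G"
    by (rule finite_subset[of _ "D \<rightarrow>\<^sub>E {1..n}"]) (use finD in \<open>auto simp: edge_maps_def intro!: finite_PiE\<close>)
  have finT: "finite (?T g)" for g
    by (auto intro: finite_subset[OF _ finite_permutations[of "{1..n}"]])
  have "closing_perms n v s r x \<subseteq> (\<Union>g\<in>?G. ?T g)"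
  proof
    fix \<tau> assume t: "\<tau> \<in> closing_perms n v s r x"
    then have tp: "\<tau> permutes {1..n}"
      and te: "\<And>i. i < v \<Longrightarrow> s (\<tau> (r (x i))) = \<tau> (x (Suc i mod v))"
      by (auto simp: closing_perms_def)
    have mem: "r (x i) \<in> D" "x (Suc i mod v) \<in> D" if "i < v" for i
      using that by (auto simp: D)
    have "restrict \<tau> D \<in> ?G"
      using te mem DS permutes_in_image[OF tp] by (auto simp: edge_maps_def)
    moreover have "\<tau> \<in> ?T (restrict \<tau> D)" using tp by simp
    ultimately show "\<tau> \<in> (\<Union>g\<in>?G. ?T g)" by blast
  qed
  then have "card (closing_perms n v s r x) \<le> card (\<Union>g\<in>?G. ?T g)"
    using finG finT by (intro card_mono) auto
  also have "\<dots> \<le> (\<Sum>g\<in>?G. card (?T g))" by (rule card_UN_le[OF finG])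
  also have "\<dots> \<le> (\<Sum>g\<in>?G. fact (n - card D))"
  proof (rule sum_mono)
    fix g assume g: "g \<in> ?G"
    show "card (?T g) \<le> fact (n - card D)"
    proof (cases "inj_on g D")
      case True
      then have "card (?T g) = fact (n - card D)"
        using g DS finD by (intro card_permutes_extending) (auto simp: edge_maps_def)
      then show ?thesis by simp
    next
      case False
      have "?T g = {}"
      proof (rule ccontr)
        assume "?T g \<noteq> {}"
        then obtain \<tau> where "\<tau> permutes {1..n}" "\<forall>d\<in>D. \<tau> d = g d" by auto
        then have "inj_on g D" using permutes_inj[of \<tau>] by (metis inj_on_cong inj_on_subset subset_UNIV)
        then show False using False by simp
      qed
      then show ?thesis by (simp only: card.empty zero_le)
    qed
  qed
  finally show ?thesis by simp
qed

text \<open>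
  A tuple \<open>x\<close> with the same pattern as \<open>x0\<close> is \<open>g \<circ> x0\<close> for a map \<open>g\<close> that follows the edges of
  the second factor: the pattern is what makes the prescription of \<open>g\<close> on both \<open>x0 i\<close> and
  \<open>r (x0 i)\<close> consistent.
\<close>
lemma card_same_coincidences_le:
  assumes r: "r permutes {1..n}" and x0: "x0 \<in> injective_tuples n v"
    and D: "D = x0 ` {..<v} \<union> (\<lambda>i. r (x0 i)) ` {..<v}"
  shows "card {x \<in> injective_tuples n v. coincidences v r x = coincidences v r x0} \<le>
    card (edge_maps n D {(x0 i, r (x0 i)) |i. i < v} r)"
proof -
  let ?E = "{(x0 i, r (x0 i)) |i. i < v}"
  let ?G = "edge_maps n D ?E r"
  have finD: "finite D" by (simp add: D)
  have finG: "finite ?G"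
    by (rule finite_subset[of _ "D \<rightarrow>\<^sub>E {1..n}"]) (use finD in \<open>auto simp: edge_maps_def intro!: finite_PiE\<close>)
  have inj0: "inj_on x0 {..<v}" using x0 by (simp add: injective_tuples_def)
  have inj1: "inj_on (\<lambda>i. r (x0 i)) {..<v}"
    using inj0 permutes_inj[OF r] by (auto simp: inj_on_def)
  have "{x \<in> injective_tuples n v. coincidences v r x = coincidences v r x0} \<subseteq>
      (\<lambda>g. \<lambda>i\<in>{..<v}. g (x0 i)) ` ?G"
  proof
    fix x assume "x \<in> {x \<in> injective_tuples n v. coincidences v r x = coincidences v r x0}"
    then have x: "x \<in> injective_tuples n v" and c: "coincidences v r x = coincidences v r x0" by auto
    define g where "g = (\<lambda>d\<in>D. if d \<in> x0 ` {..<v} then x (inv_into {..<v} x0 d)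
      else r (x (inv_into {..<v} (\<lambda>i. r (x0 i)) d)))"
    have gx: "g (x0 i) = x i" if "i < v" for i
      using that inj0 by (auto simp: g_def D)
    have gy: "g (r (x0 j)) = r (x j)" if j: "j < v" for j
    proof (cases "r (x0 j) \<in> x0 ` {..<v}")
      case True
      then obtain i where i: "i < v" "r (x0 j) = x0 i" by auto
      then have "(i, j) \<in> coincidences v r x0" using j by (simp add: coincidences_def)
      then have "x i = r (x j)" unfolding c[symmetric] by (simp add: coincidences_def)
      then show ?thesis using gx[OF i(1)] i(2) by simp
    next
      case False
      moreover have "inv_into {..<v} (\<lambda>i. r (x0 i)) (r (x0 j)) = j"
        using inv_into_f_f[OF inj1, of j] j by simp
      ultimately show ?thesis using j by (auto simp: g_def D)
    qed
    have "g d \<in> {1..n}" if d: "d \<in> D" for d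
    proof -
      obtain i where "i < v" "d = x0 i \<or> d = r (x0 i)" using d unfolding D by blast
      then show ?thesis
        using gx gy injective_tuples_range[OF x] permutes_in_image[OF r] by metis
    qed
    moreover have "g \<in> extensional D" by (simp add: g_def)
    ultimately have "g \<in> ?G" using gx gy by (auto simp: edge_maps_def PiE_def)
    moreover have "x = (\<lambda>i\<in>{..<v}. g (x0 i))"
      using x gx by (intro PiE_ext[of x "{..<v}" "\<lambda>_. {1..n}"])
        (auto simp: injective_tuples_def PiE_def Pi_def)
    ultimately show "x \<in> (\<lambda>g. \<lambda>i\<in>{..<v}. g (x0 i)) ` ?G" by blast
  qed
  then show ?thesis using finG by (rule surj_card_le[rotated])
qed

lemma card_support:
  assumes r: "inj r" and x: "inj_on x {..<v}"
  shows "card (x ` {..<v} \<union> (\<lambda>i. r (x i)) ` {..<v}) = 2 * v - card (coincidences v r x)"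
proof -
  have inj1: "inj_on (\<lambda>i. r (x i)) {..<v}"
    using x r by (auto simp: inj_on_def)
  have "x ` {..<v} \<inter> (\<lambda>i. r (x i)) ` {..<v} = (\<lambda>(i, j). x i) ` coincidences v r x"
    by (force simp: coincidences_def)
  moreover have "inj_on (\<lambda>(i, j). x i) (coincidences v r x)"
    using x r by (auto simp: inj_on_def coincidences_def)
  ultimately have "card (x ` {..<v} \<inter> (\<lambda>i. r (x i)) ` {..<v}) = card (coincidences v r x)"
    by (simp add: card_image)
  moreover have "card (x ` {..<v}) = v" "card ((\<lambda>i. r (x i)) ` {..<v}) = v"
    using x inj1 by (simp_all add: card_image)
  ultimately show ?thesis
    using card_Un_Int[of "x ` {..<v}" "(\<lambda>i. r (x i)) ` {..<v}"] by simp
qed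

section \<open>Estimates for a fixed pair of permutations\<close>

text \<open>
  Both edge bounds apply to the same support, which has \<open>d\<close> points, and each contributes
  \<open>sqrt n ^ d\<close>. As the pattern \<open>K\<close> is not generic, one of the two edge graphs has a component
  that does not consist of two vertices, and this yields the additional factor \<open>y\<close>. It may be the
  graph of \<open>r\<close>, and then the number of tuples is small, or the graph of \<open>s\<close>, and then each tuple
  has few closing permutations.
\<close>
lemma sum_card_closing_perms_same_coincidences_le:
  fixes y :: real
  assumes s: "s permutes {1..n}" and r: "r permutes {1..n}" and n: "n \<ge> 1"
    and fs: "real (card {i \<in> {1..n}. s i = i}) \<le> sqrt n * y"
    and fr: "real (card {i \<in> {1..n}. r i = i}) \<le> sqrt n * y"
    and y: "1 / sqrt n \<le> y"
    and ne: "K \<noteq> {}"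
    and d: "d = 2 * v - card K"
  shows "(\<Sum>x | x \<in> injective_tuples n v \<and> coincidences v r x = K. real (card (closing_perms n v s r x))) \<le>
    real n ^ d * fact (n - d) * (y * (1 + y) ^ (4 * v))"
proof -
  let ?S = "{x. x \<in> injective_tuples n v \<and> coincidences v r x = K}"
  define supp where "supp x = x ` {..<v} \<union> (\<lambda>i. r (x i)) ` {..<v}" for x :: "nat \<Rightarrow> nat"
  define E1 where "E1 x = {(x i, r (x i)) |i. i < v}" for x :: "nat \<Rightarrow> nat"
  define E2 where "E2 x = {(r (x i), x (Suc i mod v)) |i. i < v}" for x :: "nat \<Rightarrow> nat"
  have inj_s: "inj s" and inj_r: "inj r" using s r permutes_inj by blast+
  have y0: "y \<ge> 0" by (rule order_trans[OF _ y]) simp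
  have fin: "finite (supp x)" for x by (simp add: supp_def)
  have card_sup: "card (supp x) = d" if "x \<in> ?S" for x
    using card_support[OF inj_r, of x v] that d by (simp add: supp_def injective_tuples_def)
  have sub1: "E1 x \<subseteq> supp x \<times> supp x" "supp x \<subseteq> Field (E1 x)" for x
    by (auto simp: E1_def supp_def Field_def)
  have sub2: "E2 x \<subseteq> supp x \<times> supp x" for x
    by (auto simp: E2_def supp_def)
  have sub2': "supp x \<subseteq> Field (E2 x)" for x
  proof -
    have "x i \<in> Field (E2 x)" if "i < v" for i
    proof (cases i)
      case 0
      then have "(r (x (v - 1)), x i) \<in> E2 x"
        using that unfolding E2_def by (auto intro!: exI[of _ "v - 1"])
      then show ?thesis by (auto simp: Field_def)
    next
      case (Suc k)
      then have "(r (x k), x i) \<in> E2 x"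
        using that unfolding E2_def by (auto intro!: exI[of _ k])
      then show ?thesis by (auto simp: Field_def)
    qed
    moreover have "r (x i) \<in> Field (E2 x)" if "i < v" for i
      using that unfolding E2_def Field_def by blast
    ultimately show ?thesis by (auto simp: supp_def)
  qed
  have S_le: "card ?S \<le> card (edge_maps n (supp x) (E1 x) r)" if "x \<in> ?S" for x
    using card_same_coincidences_le[OF r, of x v "supp x"] that by (simp add: supp_def E1_def)
  have P_le: "real (card (closing_perms n v s r x)) \<le>
      real (card (edge_maps n (supp x) (E2 x) s)) * fact (n - d)" if "x \<in> ?S" for x
  proof -
    have "card (closing_perms n v s r x) \<le> card (edge_maps n (supp x) (E2 x) s) * fact (n - d)"
      using card_closing_perms_le[OF s r, of x v "supp x"] that card_sup[OF that]
      by (simp add: supp_def E2_def)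
    then have "real (card (closing_perms n v s r x)) \<le>
        real (card (edge_maps n (supp x) (E2 x) s) * fact (n - d))"
      by (simp only: of_nat_le_iff)
    then show ?thesis by simp
  qed
  define a where "a = sqrt n ^ d * (1 + y) ^ d"
  define a' where "a' = sqrt n ^ d * (y * (1 + y) ^ d)"
  have a: "a \<ge> 0" "a' \<ge> 0" using y0 by (auto simp: a_def a'_def)
  note bound1 = card_edge_maps_le_simple[OF inj_r fin sub1 n fr y, folded E1_def]
  note bound2 = card_edge_maps_le_simple[OF inj_s fin sub2 sub2' n fs y]
  have main: "(\<Sum>x\<in>?S. real (card (closing_perms n v s r x))) \<le> a * a' * fact (n - d)"
  proof (cases "\<exists>x\<in>?S. \<exists>C\<in>supp x // component_rel (supp x) (E1 x). card C \<noteq> 2")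
    case True
    then obtain x C where x: "x \<in> ?S" and C: "C \<in> supp x // component_rel (supp x) (E1 x)" "card C \<noteq> 2"
      by blast
    have cS: "real (card ?S) \<le> a'"
      using S_le[OF x] bound1(2)[OF C] card_sup[OF x] by (simp add: a'_def)
    have "real (card (closing_perms n v s r z)) \<le> a * fact (n - d)" if z: "z \<in> ?S" for z
    proof -
      have "real (card (edge_maps n (supp z) (E2 z) s)) \<le> a"
        using bound2(1)[of z] card_sup[OF z] by (simp add: a_def)
      then have "real (card (edge_maps n (supp z) (E2 z) s)) * fact (n - d) \<le> a * fact (n - d)"
        by (intro mult_right_mono) auto
      then show ?thesis using P_le[OF z] by linarith
    qed
    then have "(\<Sum>x\<in>?S. real (card (closing_perms n v s r x))) \<le> real (card ?S) * (a * fact (n - d))"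
      by (rule sum_bounded_above)
    also have "\<dots> \<le> a' * (a * fact (n - d))" using cS a by (intro mult_right_mono) auto
    finally show ?thesis by (simp add: mult_ac)
  next
    case False
    have "real (card (closing_perms n v s r z)) \<le> a' * fact (n - d)" if z: "z \<in> ?S" for z
    proof -
      obtain i j where ij: "i < v" "j < v" "z i = r (z j)"
        using z ne by (auto simp: coincidences_def)
      have zi: "inj_on z {..<v}" using z by (simp add: injective_tuples_def)
      then have zi': "inj_on (\<lambda>i. r (z i)) {..<v}" using inj_r by (auto simp: inj_on_def)
      \<comment> \<open>All components of the graph of \<open>r\<close> have two vertices, so the coincidence of \<open>z\<close> must come with
      a bad component in the graph of \<open>s\<close>.\<close>
      have two1: "\<forall>C\<in>supp z // component_rel (supp z) {(z i, r (z i)) |i. i < v}. card C = 2"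
        using False z unfolding E1_def by blast
      have "\<not> (\<forall>C\<in>supp z // component_rel (supp z) (E2 z). card C = 2)"
        using two_point_components_disjoint[OF zi zi' supp_def two1 _ ij(1,2)] ij(3)
        unfolding E2_def by blast
      then obtain C where C: "C \<in> supp z // component_rel (supp z) (E2 z)" "card C \<noteq> 2" by blast
      have "real (card (edge_maps n (supp z) (E2 z) s)) \<le> a'"
        using bound2(2)[OF C] card_sup[OF z] by (simp add: a'_def)
      then have "real (card (edge_maps n (supp z) (E2 z) s)) * fact (n - d) \<le> a' * fact (n - d)"
        by (intro mult_right_mono) auto
      then show ?thesis using P_le[OF z] by linarith
    qed
    then have le: "(\<Sum>x\<in>?S. real (card (closing_perms n v s r x))) \<le> real (card ?S) * (a' * fact (n - d))"
      by (rule sum_bounded_above)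
    have cS: "real (card ?S) \<le> a"
    proof (cases "?S = {}")
      case False
      then obtain x where x: "x \<in> ?S" by blast
      then show ?thesis using S_le[OF x] bound1(1)[of x] card_sup[OF x] by (simp add: a_def)
    qed (use a in \<open>simp only: card.empty of_nat_0\<close>)
    have "real (card ?S) * (a' * fact (n - d)) \<le> a * (a' * fact (n - d))"
      using cS a by (intro mult_right_mono) auto
    with le show ?thesis by (simp add: mult_ac)
  qed
  have "a * a' = (sqrt n * sqrt n) ^ d * (y * (1 + y) ^ (2 * d))"
    unfolding a_def a'_def power_mult_distrib mult_2 power_add by (simp only: mult_ac)
  also have "\<dots> \<le> real n ^ d * (y * (1 + y) ^ (4 * v))"
    using y0 d by (auto intro!: mult_left_mono power_increasing)
  finally have "a * a' * fact (n - d) \<le> real n ^ d * (y * (1 + y) ^ (4 * v)) * fact (n - d)"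
    by (rule mult_right_mono) simp
  also have "\<dots> = real n ^ d * fact (n - d) * (y * (1 + y) ^ (4 * v))" by (simp only: mult_ac)
  finally show ?thesis using main by linarith
qed

lemma card_PiE_determined_coordinate_le:
  assumes "i < v" "j < v" "i \<noteq> j"
  shows "card {x \<in> {..<v} \<rightarrow>\<^sub>E {1..n}. x i = f (x j)} \<le> n ^ (v - 1)"
proof -
  let ?B = "({..<v} - {i}) \<rightarrow>\<^sub>E {1..n}"
  have "card {x \<in> {..<v} \<rightarrow>\<^sub>E {1..n}. x i = f (x j)} \<le> card ?B"
  proof (rule card_inj_on_le[where f = "\<lambda>x. restrict x ({..<v} - {i})"])
    show "inj_on (\<lambda>x. restrict x ({..<v} - {i})) {x \<in> {..<v} \<rightarrow>\<^sub>E {1..n}. x i = f (x j)}"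
    proof (rule inj_onI)
      fix x z assume x: "x \<in> {x \<in> {..<v} \<rightarrow>\<^sub>E {1..n}. x i = f (x j)}"
        and z: "z \<in> {x \<in> {..<v} \<rightarrow>\<^sub>E {1..n}. x i = f (x j)}"
        and e: "restrict x ({..<v} - {i}) = restrict z ({..<v} - {i})"
      have ne: "x k = z k" if "k < v" "k \<noteq> i" for k using fun_cong[OF e, of k] that by simp
      then have "x i = z i" using x z ne[of j] assms by simp
      then have "x k = z k" if "k < v" for k using ne that by (cases "k = i") auto
      then show "x = z" using x z by (intro PiE_ext[of x "{..<v}" "\<lambda>_. {1..n}"]) auto
    qed
    show "(\<lambda>x. restrict x ({..<v} - {i})) ` {x \<in> {..<v} \<rightarrow>\<^sub>E {1..n}. x i = f (x j)} \<subseteq> ?B"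
      unfolding image_subset_iff restrict_PiE_iff by (auto simp: PiE_def Pi_def)
    show "finite ?B" by (intro finite_PiE) auto
  qed
  then show ?thesis using assms by (simp add: card_PiE)
qed

lemma card_PiE_fixed_coordinate:
  assumes "i < v"
  shows "card {x \<in> {..<v} \<rightarrow>\<^sub>E {1..n}. p (x i) = x i} = card {a \<in> {1..n}. p a = a} * n ^ (v - 1)"
proof -
  let ?F = "{a \<in> {1..n}. p a = a}"
  have "{x \<in> {..<v} \<rightarrow>\<^sub>E {1..n}. p (x i) = x i} = PiE {..<v} (\<lambda>k. if k = i then ?F else {1..n})"
    using assms by (auto simp: PiE_def Pi_def split: if_splits)
  also have "card \<dots> = (\<Prod>k<v. card (if k = i then ?F else {1..n}))" by (simp add: card_PiE)
  also have "\<dots> = card ?F * (\<Prod>k\<in>{..<v} - {i}. card (if k = i then ?F else {1..n}))"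
    using assms by (subst prod.remove[of _ i]) auto
  also have "(\<Prod>k\<in>{..<v} - {i}. card (if k = i then ?F else {1..n})) = (\<Prod>k\<in>{..<v} - {i}. n)"
    by (rule prod.cong) auto
  finally show ?thesis using assms by simp
qed

text \<open>
  Union bound: among all \<open>n ^ v\<close> tuples, an equality \<open>x i = x j\<close> or \<open>x i = p (x j)\<close> with
  \<open>i \<noteq> j\<close> removes one free coordinate, and \<open>x i = p (x i)\<close> confines a coordinate to the fixed
  points. Each costs at most a fraction \<open>y\<close>.
\<close>
lemma card_generic_tuples_ge:
  fixes y :: real
  assumes n: "n \<ge> 1" and fp: "real (card {i \<in> {1..n}. p i = i}) \<le> sqrt n * y" and y: "1 / sqrt n \<le> y"
  shows "real n ^ v * (1 - 2 * real v ^ 2 * y) \<le> real (card (generic_tuples n v p))"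
proof -
  let ?P = "{..<v} \<rightarrow>\<^sub>E {1..n}" and ?I = "{..<v} \<times> {..<v}"
  let ?A = "\<lambda>(i, j). {x \<in> ?P. i \<noteq> j \<and> x i = x j}" and ?B = "\<lambda>(i, j). {x \<in> ?P. x i = p (x j)}"
  let ?N = "generic_tuples n v p"
  have finP: "finite ?P" by (intro finite_PiE) auto
  have sn: "sqrt n \<ge> 1" using n by simp
  have sy: "1 \<le> sqrt n * y" using y sn by (simp add: field_simps)
  have single: "real n ^ (v - 1) \<le> real n ^ v * y" and fixed: "sqrt n * y * real n ^ (v - 1) \<le> real n ^ v * y"
    if "v \<ge> 1"
  proof -
    have e: "real n ^ v = sqrt n * sqrt n * real n ^ (v - 1)"
      using that by (cases v) auto
    have "1 * (sqrt n * y) \<le> sqrt n * (sqrt n * y)" using sn sy by (intro mult_right_mono) auto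
    then have 1: "sqrt n * y \<le> sqrt n * sqrt n * y" by (simp add: mult_ac)
    then show "sqrt n * y * real n ^ (v - 1) \<le> real n ^ v * y"
      unfolding e using mult_right_mono[OF 1, of "real n ^ (v - 1)"] by (simp add: mult_ac)
    have "1 \<le> sqrt n * sqrt n * y" using 1 sy by linarith
    then show "real n ^ (v - 1) \<le> real n ^ v * y"
      unfolding e using mult_right_mono[of 1 "sqrt n * sqrt n * y" "real n ^ (v - 1)"] by (simp add: mult_ac)
  qed
  have y0: "y \<ge> 0" using sy sn by (smt (verit) mult_nonneg_nonpos)
  have A: "real (card (?A q)) \<le> real n ^ v * y" if q: "q \<in> ?I" for q
  proof -
    obtain i j where [simp]: "q = (i, j)" and ij: "i < v" "j < v" using q by auto
    show ?thesis
    proof (cases "i = j")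
      case False
      then have "card (?A q) \<le> n ^ (v - 1)"
        using card_PiE_determined_coordinate_le[OF ij, where f = id] by simp
      then have "real (card (?A q)) \<le> real n ^ (v - 1)" by (simp only: of_nat_power[symmetric] of_nat_le_iff)
      then show ?thesis using single ij by linarith
    qed (use y0 in simp)
  qed
  have B: "real (card (?B q)) \<le> real n ^ v * y" if q: "q \<in> ?I" for q
  proof -
    obtain i j where [simp]: "q = (i, j)" and ij: "i < v" "j < v" using q by auto
    show ?thesis
    proof (cases "i = j")
      case False
      then have "card (?B q) \<le> n ^ (v - 1)"
        using card_PiE_determined_coordinate_le[OF ij, where f = p] by simp
      then have "real (card (?B q)) \<le> real n ^ (v - 1)" by (simp only: of_nat_power[symmetric] of_nat_le_iff)
      then show ?thesis using single ij by linarith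
    next
      case True
      have "?B q = {x \<in> ?P. p (x i) = x i}"
        unfolding True[symmetric] \<open>q = (i, j)\<close> prod.case by (rule Collect_cong) metis
      then have "card (?B q) = card {a \<in> {1..n}. p a = a} * n ^ (v - 1)"
        using card_PiE_fixed_coordinate[OF ij(1)] by simp
      then have "real (card (?B q)) = real (card {a \<in> {1..n}. p a = a}) * real n ^ (v - 1)" by simp
      also have "\<dots> \<le> sqrt n * y * real n ^ (v - 1)" using fp by (intro mult_right_mono) auto
      also have "\<dots> \<le> real n ^ v * y" using fixed ij by linarith
      finally show ?thesis .
    qed
  qed
  have NP: "?N \<subseteq> ?P" by (auto simp: generic_tuples_def injective_tuples_def)
  have "?P \<subseteq> ?N \<union> ((\<Union>q\<in>?I. ?A q) \<union> (\<Union>q\<in>?I. ?B q))"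
    by (auto simp: generic_tuples_def injective_tuples_def coincidences_def inj_on_def)
  then have "card ?P \<le> card (?N \<union> ((\<Union>q\<in>?I. ?A q) \<union> (\<Union>q\<in>?I. ?B q)))"
    using finP NP by (intro card_mono) (auto intro: finite_subset)
  also have "\<dots> \<le> card ?N + (card (\<Union>q\<in>?I. ?A q) + card (\<Union>q\<in>?I. ?B q))"
    by (intro order_trans[OF card_Un_le] add_mono card_Un_le order_refl)
  also have "\<dots> \<le> card ?N + ((\<Sum>q\<in>?I. card (?A q)) + (\<Sum>q\<in>?I. card (?B q)))"
    by (intro add_mono card_UN_le order_refl) auto
  finally have "real (card ?P) \<le> real (card ?N) + ((\<Sum>q\<in>?I. real (card (?A q))) + (\<Sum>q\<in>?I. real (card (?B q))))"
    by (simp only: of_nat_le_iff of_nat_add[symmetric] of_nat_sum[symmetric])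
  also have "\<dots> \<le> real (card ?N) + (real (card ?I) * (real n ^ v * y) + real (card ?I) * (real n ^ v * y))"
    by (intro add_mono sum_bounded_above A B order_refl)
  finally show ?thesis by (simp add: card_PiE algebra_simps power2_eq_square)
qed

lemma power_fact_diff_mono:
  assumes "d \<le> m" "m \<le> n"
  shows "n ^ d * fact (n - d) \<le> n ^ m * (fact (n - m) :: nat)"
  using assms
proof (induction m rule: dec_induct)
  case (step k)
  have "n ^ k * fact (n - k) = n ^ k * ((n - k) * (fact (n - Suc k) :: nat))"
    using step.prems by (subst fact_reduce) auto
  also have "\<dots> \<le> n ^ k * (n * fact (n - Suc k))" by (intro mult_left_mono mult_right_mono) auto
  finally have "n ^ k * fact (n - k) \<le> n ^ Suc k * (fact (n - Suc k) :: nat)"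
    by (simp only: power_Suc mult_ac)
  moreover have "n ^ d * fact (n - d) \<le> n ^ k * (fact (n - k) :: nat)"
    using step by simp
  ultimately show ?case by (rule order_trans[rotated])
qed simp

lemma power_fact_ratio_tendsto_1:
  "(\<lambda>n. real n ^ m * fact (n - m) / fact n) \<longlonglongrightarrow> 1"
proof (induction m)
  case (Suc m)
  have "(\<lambda>n. real n / (real n - real m)) \<longlonglongrightarrow> 1" by real_asymp
  from tendsto_mult[OF Suc.IH this]
  have "(\<lambda>n. (real n ^ m * fact (n - m) / fact n) * (real n / (real n - real m))) \<longlonglongrightarrow> 1" by simp
  moreover have "\<forall>\<^sub>F n in sequentially. (real n ^ m * fact (n - m) / fact n) * (real n / (real n - real m)) =
      real n ^ Suc m * fact (n - Suc m) / fact n"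
    using eventually_gt_at_top[of m]
  proof eventually_elim
    case (elim n)
    then have f: "(fact (n - m) :: real) = (real n - real m) * fact (n - Suc m)"
      by (subst fact_reduce) auto
    have "real n - real m \<noteq> 0" using elim by simp
    then show ?case unfolding f by (simp add: mult_ac)
  qed
  ultimately show ?case by (rule Lim_transform_eventually)
qed simp

text \<open>
  The sum over tuples is split by pattern. The generic tuples contribute
  \<open>card (generic_tuples n v r) * card (generic_tuples n v s) * fact (n - 2 * v)\<close>, which is close
  to \<open>n ^ (2 * v) * fact (n - 2 * v)\<close>, and the at most \<open>2 ^ (v * v)\<close> other patterns are each
  smaller by the factor \<open>y\<close>.
\<close>
lemma average_cyclic_tuples_bound:
  fixes y c :: real
  assumes s: "s permutes {1..n}" and r: "r permutes {1..n}" and n: "n \<ge> 1" "n \<ge> 2 * v"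
    and fs: "real (card {i \<in> {1..n}. s i = i}) \<le> sqrt n * y"
    and fr: "real (card {i \<in> {1..n}. r i = i}) \<le> sqrt n * y"
    and y: "1 / sqrt n \<le> y"
    and c: "c = real n ^ (2 * v) * fact (n - 2 * v) / fact n"
  shows "\<bar>(\<Sum>\<tau> | \<tau> permutes {1..n}. real (card (cyclic_tuples n v (inv \<tau> \<circ> s \<circ> \<tau> \<circ> r)))) / fact n - 1\<bar>
    \<le> (c - 1) + c * (4 * real v ^ 2 * y + 2 ^ (v * v) * (y * (1 + y) ^ (4 * v)))"
proof -
  let ?X = "injective_tuples n v" and ?W = "\<lambda>x. real (card (closing_perms n v s r x))"
  let ?N = "generic_tuples n v"
  have y0: "y \<ge> 0" by (rule order_trans[OF _ y]) simp
  have F: "real n ^ (2 * v) * fact (n - 2 * v) = c * fact n" unfolding c by simp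
  have ratio: "real n ^ d * fact (n - d) \<le> c * fact n" if "d \<le> 2 * v" for d
  proof -
    have "real (n ^ d * fact (n - d)) \<le> real (n ^ (2 * v) * fact (n - 2 * v))"
      using power_fact_diff_mono[OF that n(2)] by (simp only: of_nat_le_iff)
    then show ?thesis using F by simp
  qed
  have c1: "c \<ge> 1" using ratio[of 0] by simp
  have fN: "?N r \<subseteq> ?X" by (auto simp: generic_tuples_def)
  have N_le: "real (card (?N p)) \<le> real n ^ v" for p
  proof -
    have "card (?N p) \<le> card ({..<v} \<rightarrow>\<^sub>E {1..n})"
      by (intro card_mono finite_PiE) (auto simp: generic_tuples_def injective_tuples_def)
    then have "card (?N p) \<le> n ^ v" by (simp add: card_PiE)
    then show ?thesis by (simp only: of_nat_power[symmetric] of_nat_le_iff)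
  qed
  have gen: "(\<Sum>x\<in>?N r. ?W x) = real (card (?N r)) * real (card (?N s)) * fact (n - 2 * v)"
  proof -
    have "(\<Sum>x\<in>?N r. ?W x) = (\<Sum>x\<in>?N r. real (card (?N s)) * fact (n - 2 * v))"
      by (rule sum.cong) (simp_all add: card_closing_perms_generic[OF s r])
    then show ?thesis by simp
  qed
  have gen_le: "(\<Sum>x\<in>?N r. ?W x) \<le> c * fact n"
  proof -
    have "real (card (?N r)) * real (card (?N s)) \<le> real n ^ v * real n ^ v"
      by (intro mult_mono N_le) auto
    also have "\<dots> = real n ^ (2 * v)" by (simp add: mult_2 power_add)
    finally show ?thesis unfolding gen F[symmetric] by (intro mult_right_mono) auto
  qed
  \<comment> \<open>The lower bound is trivial unless \<open>2 * v\<^sup>2 * y \<le> 1\<close>; then it is Bernoulli's inequality \<open>(1 - e)\<^sup>2 \<ge> 1 - 2 * e\<close>.\<close>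
  have gen_ge: "c * fact n * (1 - 4 * real v ^ 2 * y) \<le> (\<Sum>x\<in>?N r. ?W x)"
  proof (cases "2 * real v ^ 2 * y \<le> 1")
    case True
    let ?e = "2 * real v ^ 2 * y"
    have "1 - 2 * e \<le> (1 - e) ^ 2" for e :: real
      using zero_le_power2[of e] by (simp add: power2_eq_square algebra_simps)
    then have "real n ^ (2 * v) * (1 - 2 * ?e) \<le> real n ^ (2 * v) * (1 - ?e) ^ 2"
      by (rule mult_left_mono) simp
    also have "\<dots> = (real n ^ v * (1 - ?e)) * (real n ^ v * (1 - ?e))"
      unfolding mult_2 power_add power2_eq_square by (simp only: mult_ac)
    also have "\<dots> \<le> real (card (?N r)) * real (card (?N s))"
      using True by (intro mult_mono card_generic_tuples_ge n(1) fs fr y) auto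
    finally have "real n ^ (2 * v) * (1 - 2 * ?e) * fact (n - 2 * v) \<le> (\<Sum>x\<in>?N r. ?W x)"
      unfolding gen by (intro mult_right_mono) auto
    moreover have "real n ^ (2 * v) * (1 - 2 * ?e) * fact (n - 2 * v) = c * fact n * (1 - 4 * real v ^ 2 * y)"
      unfolding F[symmetric] by (simp add: mult_ac)
    ultimately show ?thesis by simp
  next
    case False
    then have "c * fact n * (1 - 4 * real v ^ 2 * y) \<le> 0"
      using c1 by (intro mult_nonneg_nonpos) auto
    also have "0 \<le> (\<Sum>x\<in>?N r. ?W x)" by (intro sum_nonneg) auto
    finally show ?thesis .
  qed
  let ?b = "c * fact n * (y * (1 + y) ^ (4 * v))"
  have b0: "?b \<ge> 0" using c1 y0 by simp
  have nongen_le: "(\<Sum>x\<in>?X - ?N r. ?W x) \<le> 2 ^ (v * v) * ?b"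
  proof -
    let ?k = "coincidences v r"
    let ?I = "?k ` (?X - ?N r)"
    have I: "?I \<subseteq> Pow ({..<v} \<times> {..<v})" by (auto simp: coincidences_def)
    have cI: "card ?I \<le> 2 ^ (v * v)"
      using card_mono[OF _ I] by (simp add: card_Pow)
    have "(\<Sum>x\<in>?X - ?N r. ?W x) = (\<Sum>K\<in>?I. \<Sum>x | x \<in> ?X - ?N r \<and> ?k x = K. ?W x)"
      by (rule sum.image_gen) simp
    also have "\<dots> \<le> (\<Sum>K\<in>?I. ?b)"
    proof (rule sum_mono)
      fix K assume K: "K \<in> ?I"
      then have ne: "K \<noteq> {}" by (auto simp: generic_tuples_def)
      have e: "{x. x \<in> ?X - ?N r \<and> ?k x = K} = {x. x \<in> ?X \<and> ?k x = K}"
        using ne by (auto simp: generic_tuples_def)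
      define d where "d = 2 * v - card K"
      have "(\<Sum>x | x \<in> ?X \<and> ?k x = K. ?W x) \<le> real n ^ d * fact (n - d) * (y * (1 + y) ^ (4 * v))"
        by (rule sum_card_closing_perms_same_coincidences_le[OF s r n(1) fs fr y ne d_def])
      also have "\<dots> \<le> ?b"
        using y0 by (intro mult_right_mono ratio) (auto simp: d_def)
      finally show "(\<Sum>x | x \<in> ?X - ?N r \<and> ?k x = K. ?W x) \<le> ?b" unfolding e .
    qed
    also have "\<dots> = real (card ?I) * ?b" by (rule sum_constant)
    also have "\<dots> \<le> 2 ^ (v * v) * ?b"
      using of_nat_mono[OF cI, where 'a = real] b0 by (intro mult_right_mono) simp_all
    finally show ?thesis .
  qed
  have nongen_ge: "0 \<le> (\<Sum>x\<in>?X - ?N r. ?W x)" by (intro sum_nonneg) auto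
  define T where "T = (\<Sum>\<tau> | \<tau> permutes {1..n}. real (card (cyclic_tuples n v (inv \<tau> \<circ> s \<circ> \<tau> \<circ> r))))"
  have "T = real (\<Sum>\<tau> | \<tau> permutes {1..n}. card (cyclic_tuples n v (inv \<tau> \<circ> s \<circ> \<tau> \<circ> r)))"
    by (simp add: T_def)
  also have "\<dots> = (\<Sum>x\<in>?X. ?W x)"
    unfolding sum_card_cyclic_tuples_conj by simp
  also have "\<dots> = (\<Sum>x\<in>?X - ?N r. ?W x) + (\<Sum>x\<in>?N r. ?W x)"
    using fN by (intro sum.subset_diff) auto
  finally have T: "T = (\<Sum>x\<in>?X - ?N r. ?W x) + (\<Sum>x\<in>?N r. ?W x)" .
  have up: "T / fact n \<le> c + 2 ^ (v * v) * (c * (y * (1 + y) ^ (4 * v)))"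
  proof -
    have "T \<le> (c + 2 ^ (v * v) * (c * (y * (1 + y) ^ (4 * v)))) * fact n"
      using T gen_le nongen_le by (simp add: algebra_simps)
    then show ?thesis by (simp add: divide_le_eq)
  qed
  have lo: "c * (1 - 4 * real v ^ 2 * y) \<le> T / fact n"
    using T gen_ge nongen_ge by (simp add: le_divide_eq algebra_simps)
  have "0 \<le> c * (4 * real v ^ 2 * y)" "0 \<le> c * (2 ^ (v * v) * (y * (1 + y) ^ (4 * v)))"
    using c1 y0 by auto
  with up lo c1 show ?thesis
    unfolding T_def[symmetric] by (simp add: abs_le_iff algebra_simps)
qed

section \<open>Random permutations\<close>

text \<open>
  The product of the two discrete spaces is again discrete because they are finite; so every
  function of a pair of random permutations is measurable.
\<close>
lemma measurable_perm_pair: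
  fixes h :: "(nat \<Rightarrow> nat) \<Rightarrow> (nat \<Rightarrow> nat) \<Rightarrow> 'b"
  assumes X: "X \<in> measurable M (perm_space n)" and Y: "Y \<in> measurable M (perm_space n)"
    and h: "\<And>p q. p permutes {1..n} \<Longrightarrow> q permutes {1..n} \<Longrightarrow> h p q \<in> space N"
  shows "(\<lambda>\<omega>. h (X \<omega>) (Y \<omega>)) \<in> measurable M N"
proof -
  let ?P = "{p. p permutes {1..n}}"
  have "countable ?P" by (simp add: countable_finite finite_permutations)
  then have eq: "perm_space n \<Otimes>\<^sub>M perm_space n = count_space (?P \<times> ?P)"
    unfolding perm_space_def by (intro pair_measure_countable)
  have "(\<lambda>(p, q). h p q) \<in> measurable (perm_space n \<Otimes>\<^sub>M perm_space n) N"
    unfolding eq by (auto intro: h)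
  from measurable_compose[OF measurable_Pair[OF X Y] this] show ?thesis by simp
qed

lemma perm_space_permutes:
  "X \<in> measurable M (perm_space n) \<Longrightarrow> \<omega> \<in> space M \<Longrightarrow> X \<omega> permutes {1..n}"
  using measurable_space[of X M "perm_space n" \<omega>] by (simp add: perm_space_def)

lemma (in prob_space) integrable_perm_pair:
  fixes h :: "(nat \<Rightarrow> nat) \<Rightarrow> (nat \<Rightarrow> nat) \<Rightarrow> real"
  assumes X: "X \<in> measurable M (perm_space n)" and Y: "Y \<in> measurable M (perm_space n)"
  shows "integrable M (\<lambda>\<omega>. h (X \<omega>) (Y \<omega>))"
proof -
  let ?P = "{p. p permutes {1..n}}"
  let ?H = "(\<lambda>(p, q). \<bar>h p q\<bar>) ` (?P \<times> ?P)"
  have "\<bar>h (X \<omega>) (Y \<omega>)\<bar> \<le> Max ?H" if "\<omega> \<in> space M" for \<omega>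
    using perm_space_permutes[OF X that] perm_space_permutes[OF Y that]
    by (intro Max_ge) (auto simp: finite_permutations)
  then show ?thesis
    by (intro integrable_const_bound[where B = "Max ?H"] measurable_perm_pair[OF X Y]) auto
qed

lemma (in prob_space) indep_var_commute:
  assumes "indep_var S X T Y"
  shows "indep_var T Y S X"
proof -
  have "indep_set B A" if "indep_set A B" for A B
    unfolding indep_sets2_eq
  proof (intro conjI ballI)
    fix b a assume "b \<in> B" "a \<in> A"
    then have "prob (a \<inter> b) = prob a * prob b" using that unfolding indep_sets2_eq by blast
    then show "prob (b \<inter> a) = prob b * prob a" by (simp only: Int_commute mult.commute)
  qed (use that in \<open>simp_all add: indep_sets2_eq\<close>)
  then show ?thesis using assms unfolding indep_var_eq by blast
qed

text \<open>
  By independence, conjugating \<open>X\<close> by a fixed \<open>\<tau>\<close> does not change the joint law of \<open>X\<close> and \<open>Y\<close>;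
  averaging over all \<open>\<tau>\<close> introduces the uniform conjugation for which the counting is done.
\<close>
lemma (in prob_space) integral_average_conjugation:
  fixes h :: "(nat \<Rightarrow> nat) \<Rightarrow> (nat \<Rightarrow> nat) \<Rightarrow> real"
  assumes X: "X \<in> measurable M (perm_space n)" and Y: "Y \<in> measurable M (perm_space n)"
    and indep: "indep_var (perm_space n) X (perm_space n) Y"
    and conj: "\<And>\<tau>. \<tau> permutes {1..n} \<Longrightarrow>
      distr M (perm_space n) (\<lambda>\<omega>. inv \<tau> \<circ> X \<omega> \<circ> \<tau>) = distr M (perm_space n) X"
  shows "(\<integral>\<omega>. h (X \<omega>) (Y \<omega>) \<partial>M) =
    (\<integral>\<omega>. (\<Sum>\<tau> | \<tau> permutes {1..n}. h (inv \<tau> \<circ> X \<omega> \<circ> \<tau>) (Y \<omega>)) / fact n \<partial>M)"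
proof -
  let ?S = "perm_space n" and ?P = "{\<tau>. \<tau> permutes {1..n}}"
  have one: "(\<integral>\<omega>. h (inv \<tau> \<circ> X \<omega> \<circ> \<tau>) (Y \<omega>) \<partial>M) = (\<integral>\<omega>. h (X \<omega>) (Y \<omega>) \<partial>M)"
    if \<tau>: "\<tau> permutes {1..n}" for \<tau>
  proof -
    let ?X' = "\<lambda>\<omega>. inv \<tau> \<circ> X \<omega> \<circ> \<tau>"
    have "(\<lambda>p. inv \<tau> \<circ> p \<circ> \<tau>) \<in> measurable ?S ?S"
      unfolding perm_space_def using \<tau> by (auto intro!: permutes_compose permutes_inv)
    then have "indep_var ?S ((\<lambda>p. inv \<tau> \<circ> p \<circ> \<tau>) \<circ> X) ?S ((\<lambda>p. p) \<circ> Y)"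
      by (rule indep_var_compose[OF indep]) simp
    then have indep': "indep_var ?S ?X' ?S Y" by (simp add: o_def)
    then have X': "?X' \<in> measurable M ?S" unfolding indep_var_eq by blast
    have "distr M (?S \<Otimes>\<^sub>M ?S) (\<lambda>\<omega>. (?X' \<omega>, Y \<omega>)) = distr M ?S ?X' \<Otimes>\<^sub>M distr M ?S Y"
      using indep' unfolding indep_var_distribution_eq by simp
    also have "\<dots> = distr M ?S X \<Otimes>\<^sub>M distr M ?S Y" using conj[OF \<tau>] by simp
    also have "\<dots> = distr M (?S \<Otimes>\<^sub>M ?S) (\<lambda>\<omega>. (X \<omega>, Y \<omega>))"
      using indep unfolding indep_var_distribution_eq by simp
    finally have law: "distr M (?S \<Otimes>\<^sub>M ?S) (\<lambda>\<omega>. (?X' \<omega>, Y \<omega>)) =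
      distr M (?S \<Otimes>\<^sub>M ?S) (\<lambda>\<omega>. (X \<omega>, Y \<omega>))" .
    have h: "(\<lambda>z. h (fst z) (snd z)) \<in> borel_measurable (?S \<Otimes>\<^sub>M ?S)"
      by (rule measurable_perm_pair[OF measurable_fst measurable_snd]) simp
    have "(\<integral>\<omega>. h (?X' \<omega>) (Y \<omega>) \<partial>M) =
        (\<integral>z. h (fst z) (snd z) \<partial>distr M (?S \<Otimes>\<^sub>M ?S) (\<lambda>\<omega>. (?X' \<omega>, Y \<omega>)))"
      by (subst integral_distr[OF measurable_Pair[OF X' Y] h]) simp
    also have "\<dots> = (\<integral>\<omega>. h (X \<omega>) (Y \<omega>) \<partial>M)"
      unfolding law by (subst integral_distr[OF measurable_Pair[OF X Y] h]) simp
    finally show ?thesis .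
  qed
  have "(\<integral>\<omega>. (\<Sum>\<tau>\<in>?P. h (inv \<tau> \<circ> X \<omega> \<circ> \<tau>) (Y \<omega>)) / fact n \<partial>M) =
      (\<Sum>\<tau>\<in>?P. \<integral>\<omega>. h (inv \<tau> \<circ> X \<omega> \<circ> \<tau>) (Y \<omega>) \<partial>M) / fact n"
    by (simp add: Bochner_Integration.integral_sum integrable_perm_pair[OF X Y, where h = "\<lambda>p q. h (inv _ \<circ> p \<circ> _) q"])
  also have "\<dots> = (\<Sum>\<tau>\<in>?P. \<integral>\<omega>. h (X \<omega>) (Y \<omega>) \<partial>M) / fact n"
    using one by simp
  also have "\<dots> = (\<integral>\<omega>. h (X \<omega>) (Y \<omega>) \<partial>M)"
    using card_permutations[of "{1..n}" n] by simp
  finally show ?thesis by simp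
qed

lemma power_sum3_le:
  fixes a b c :: real
  assumes "a \<ge> 0" "b \<ge> 0" "c \<ge> 0"
  shows "(a + b + c) ^ k \<le> 3 ^ k * (a ^ k + b ^ k + c ^ k)"
proof -
  define m where "m = max a (max b c)"
  have "(a + b + c) ^ k \<le> (3 * m) ^ k" using assms by (intro power_mono) (auto simp: m_def)
  also have "\<dots> = 3 ^ k * m ^ k" by (rule power_mult_distrib)
  also have "m ^ k \<le> a ^ k + b ^ k + c ^ k" using assms by (auto simp: m_def max_def)
  finally show ?thesis by simp
qed

lemma mult_power_one_plus_le:
  fixes y :: real
  assumes "y \<ge> 0"
  shows "y * (1 + y) ^ k \<le> 2 ^ k * (y + y ^ Suc k)"
proof -
  have "(1 + y) ^ k \<le> (2 * max 1 y) ^ k" using assms by (intro power_mono) auto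
  also have "\<dots> = 2 ^ k * max 1 y ^ k" by (rule power_mult_distrib)
  also have "max 1 y ^ k \<le> 1 + y ^ k" using assms by (auto simp: max_def)
  finally have "(1 + y) ^ k \<le> 2 ^ k * (1 + y ^ k)" by simp
  then have "y * (1 + y) ^ k \<le> y * (2 ^ k * (1 + y ^ k))" using assms by (intro mult_left_mono)
  then show ?thesis by (simp add: algebra_simps)
qed

text \<open>
  The deterministic bound is applied pointwise with \<open>y\<close> the sum of both normalized fixed point
  counts and \<open>1 / sqrt n\<close>. It is polynomial in \<open>y\<close>, hence its expectation is controlled by the
  first moment and one high moment of these counts.
\<close>
lemma (in prob_space) expectation_cycle_count_bound:
  fixes m :: "nat \<Rightarrow> real"
  assumes X: "X \<in> measurable M (perm_space n)" and Y: "Y \<in> measurable M (perm_space n)"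
    and indep: "indep_var (perm_space n) X (perm_space n) Y"
    and conj: "\<And>\<tau>. \<tau> permutes {1..n} \<Longrightarrow>
      distr M (perm_space n) (\<lambda>\<omega>. inv \<tau> \<circ> X \<omega> \<circ> \<tau>) = distr M (perm_space n) X"
    and n: "n \<ge> 1" "n \<ge> 2 * v" and v: "v \<ge> 1"
    and c: "c = real n ^ (2 * v) * fact (n - 2 * v) / fact n"
    and m: "\<And>k. m k = (\<integral>\<omega>. (real (cycle_count n 1 (X \<omega>)) / sqrt n) ^ k \<partial>M) +
      (\<integral>\<omega>. (real (cycle_count n 1 (Y \<omega>)) / sqrt n) ^ k \<partial>M) + (1 / sqrt n) ^ k"
    and L: "L = 4 * real v ^ 2 + 2 ^ (v * v) * 2 ^ (4 * v)"
  shows "\<bar>real v * (\<integral>\<omega>. real (cycle_count n v (X \<omega> \<circ> Y \<omega>)) \<partial>M) - 1\<bar> \<le>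
    (c - 1) + c * L * (3 * m 1 + 3 ^ (4 * v + 1) * m (4 * v + 1))"
proof -
  define f where "f p = real (cycle_count n 1 p) / sqrt n" for p
  define y where "y p q = f p + f q + 1 / sqrt n" for p q
  define Q where "Q p q = (\<Sum>\<tau> | \<tau> permutes {1..n}. real (card (cyclic_tuples n v (inv \<tau> \<circ> p \<circ> \<tau> \<circ> q)))) / fact n"
    for p q
  note int = integrable_perm_pair[OF X Y]
  have int_y: "integrable M (\<lambda>\<omega>. y (X \<omega>) (Y \<omega>) ^ k)" for k
    by (rule int[where h = "\<lambda>p q. y p q ^ k"])
  have f0: "f p \<ge> 0" for p by (simp add: f_def)
  have sn: "sqrt n > 0" using n by simp
  have c1: "c \<ge> 0" unfolding c by simp
  have L0: "L \<ge> 0" unfolding L by simp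
  have y0: "y p q \<ge> 0" for p q using f0 sn by (simp add: y_def)
  have fix_le: "real (card {i \<in> {1..n}. p i = i}) \<le> sqrt n * y p q"
    "real (card {i \<in> {1..n}. q i = i}) \<le> sqrt n * y p q" for p q
    using f0 sn unfolding y_def f_def cycle_count_1 by (auto simp: field_simps)
  have Q: "\<bar>Q p q - 1\<bar> \<le> (c - 1) + c * L * (y p q ^ 1 + y p q ^ (4 * v + 1))"
    if "p permutes {1..n}" "q permutes {1..n}" for p q
  proof -
    let ?y = "y p q"
    have "\<bar>Q p q - 1\<bar> \<le> (c - 1) + c * (4 * real v ^ 2 * ?y + 2 ^ (v * v) * (?y * (1 + ?y) ^ (4 * v)))"
      unfolding Q_def
      by (rule average_cyclic_tuples_bound[OF that n fix_le _ c]) (use f0 in \<open>simp add: y_def\<close>)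
    also have "\<dots> \<le> (c - 1) + c * (4 * real v ^ 2 * (?y + ?y ^ (4 * v + 1)) +
        2 ^ (v * v) * (2 ^ (4 * v) * (?y + ?y ^ (4 * v + 1))))"
      using c1 y0[of p q] mult_power_one_plus_le[OF y0[of p q], of "4 * v"]
      by (intro add_mono mult_left_mono order_refl) auto
    also have "\<dots> = (c - 1) + c * L * (?y ^ 1 + ?y ^ (4 * v + 1))"
      unfolding L by (simp add: algebra_simps)
    finally show ?thesis .
  qed
  have moment: "(\<integral>\<omega>. y (X \<omega>) (Y \<omega>) ^ k \<partial>M) \<le> 3 ^ k * m k" for k
  proof -
    have "(\<integral>\<omega>. y (X \<omega>) (Y \<omega>) ^ k \<partial>M) \<le>
        (\<integral>\<omega>. 3 ^ k * (f (X \<omega>) ^ k + f (Y \<omega>) ^ k + (1 / sqrt n) ^ k) \<partial>M)"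
      by (rule integral_mono[OF int_y int[where h = "\<lambda>p q. 3 ^ k * (f p ^ k + f q ^ k + (1 / sqrt n) ^ k)"]])
        (unfold y_def, intro power_sum3_le f0, simp)
    also have "\<dots> = 3 ^ k * m k"
      using int[where h = "\<lambda>p q. f p ^ k"] int[where h = "\<lambda>p q. f q ^ k"]
      unfolding m by (simp add: f_def prob_space)
    finally show ?thesis .
  qed
  have "real v * (\<integral>\<omega>. real (cycle_count n v (X \<omega> \<circ> Y \<omega>)) \<partial>M) =
      (\<integral>\<omega>. real v * real (cycle_count n v (X \<omega> \<circ> Y \<omega>)) \<partial>M)" by simp
  also have "\<dots> = (\<integral>\<omega>. real (card (cyclic_tuples n v (X \<omega> \<circ> Y \<omega>))) \<partial>M)"
    using perm_space_permutes[OF X] perm_space_permutes[OF Y]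
    by (intro Bochner_Integration.integral_cong) (auto simp: card_cyclic_tuples[OF permutes_compose v])
  also have "\<dots> = (\<integral>\<omega>. Q (X \<omega>) (Y \<omega>) \<partial>M)"
    unfolding Q_def
    by (rule integral_average_conjugation[OF X Y indep conj, where h = "\<lambda>p q. real (card (cyclic_tuples n v (p \<circ> q)))"])
  finally have E: "real v * (\<integral>\<omega>. real (cycle_count n v (X \<omega> \<circ> Y \<omega>)) \<partial>M) = (\<integral>\<omega>. Q (X \<omega>) (Y \<omega>) \<partial>M)" .
  have intQ: "integrable M (\<lambda>\<omega>. Q (X \<omega>) (Y \<omega>))" by (rule int)
  have "\<bar>(\<integral>\<omega>. Q (X \<omega>) (Y \<omega>) \<partial>M) - 1\<bar> = \<bar>\<integral>\<omega>. Q (X \<omega>) (Y \<omega>) - 1 \<partial>M\<bar>"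
    using intQ by (simp add: prob_space)
  also have "\<dots> \<le> (\<integral>\<omega>. \<bar>Q (X \<omega>) (Y \<omega>) - 1\<bar> \<partial>M)" by (rule integral_abs_bound)
  also have "\<dots> \<le> (\<integral>\<omega>. (c - 1) + c * L * (y (X \<omega>) (Y \<omega>) ^ 1 + y (X \<omega>) (Y \<omega>) ^ (4 * v + 1)) \<partial>M)"
    using Q perm_space_permutes[OF X] perm_space_permutes[OF Y]
    by (intro integral_mono int[where h = "\<lambda>p q. \<bar>Q p q - 1\<bar>"]
        int[where h = "\<lambda>p q. (c - 1) + c * L * (y p q ^ 1 + y p q ^ (4 * v + 1))"]) blast
  also have "\<dots> = (c - 1) + c * L * ((\<integral>\<omega>. y (X \<omega>) (Y \<omega>) ^ 1 \<partial>M) + (\<integral>\<omega>. y (X \<omega>) (Y \<omega>) ^ (4 * v + 1) \<partial>M))"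
    using int_y[of 1] int_y[of "4 * v + 1"] by (simp add: prob_space)
  also have "\<dots> \<le> (c - 1) + c * L * (3 ^ 1 * m 1 + 3 ^ (4 * v + 1) * m (4 * v + 1))"
    using c1 L0 by (intro add_mono mult_left_mono order_refl moment) auto
  finally show ?thesis unfolding E by simp
qed

lemma expectation_cycle_count_tendsto:
  fixes M :: "nat \<Rightarrow> 'a measure" and X Y :: "nat \<Rightarrow> 'a \<Rightarrow> nat \<Rightarrow> nat"
  assumes prob: "\<And>n. n \<ge> 1 \<Longrightarrow> prob_space (M n)"
    and X: "\<And>n. n \<ge> 1 \<Longrightarrow> X n \<in> measurable (M n) (perm_space n)"
    and Y: "\<And>n. n \<ge> 1 \<Longrightarrow> Y n \<in> measurable (M n) (perm_space n)"
    and indep: "\<And>n. n \<ge> 1 \<Longrightarrow> prob_space.indep_var (M n) (perm_space n) (X n) (perm_space n) (Y n)"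
    and conj: "\<And>n \<tau>. n \<ge> 1 \<Longrightarrow> \<tau> permutes {1..n} \<Longrightarrow>
      distr (M n) (perm_space n) (\<lambda>\<omega>. inv \<tau> \<circ> X n \<omega> \<circ> \<tau>) = distr (M n) (perm_space n) (X n)"
    and fX: "\<And>k. k \<ge> 1 \<Longrightarrow> (\<lambda>n. \<integral>\<omega>. (real (cycle_count n 1 (X n \<omega>)) / sqrt n) ^ k \<partial>M n) \<longlonglongrightarrow> 0"
    and fY: "\<And>k. k \<ge> 1 \<Longrightarrow> (\<lambda>n. \<integral>\<omega>. (real (cycle_count n 1 (Y n \<omega>)) / sqrt n) ^ k \<partial>M n) \<longlonglongrightarrow> 0"
    and v: "v \<ge> 1"
  shows "(\<lambda>n. \<integral>\<omega>. real (cycle_count n v (X n \<omega> \<circ> Y n \<omega>)) \<partial>M n) \<longlonglongrightarrow> 1 / real v"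
proof -
  define c where "c n = real n ^ (2 * v) * fact (n - 2 * v) / fact n" for n :: nat
  define m where "m n k = (\<integral>\<omega>. (real (cycle_count n 1 (X n \<omega>)) / sqrt n) ^ k \<partial>M n) +
      (\<integral>\<omega>. (real (cycle_count n 1 (Y n \<omega>)) / sqrt n) ^ k \<partial>M n) + (1 / sqrt n) ^ k" for n k :: nat
  define L where "L = 4 * real v ^ 2 + 2 ^ (v * v) * 2 ^ (4 * v)"
  let ?I = "\<lambda>n. \<integral>\<omega>. real (cycle_count n v (X n \<omega> \<circ> Y n \<omega>)) \<partial>M n"
  let ?B = "\<lambda>n. (c n - 1) + c n * L * (3 * m n 1 + 3 ^ (4 * v + 1) * m n (4 * v + 1))"
  have lim_c: "c \<longlonglongrightarrow> 1" unfolding c_def by (rule power_fact_ratio_tendsto_1)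
  have lim_m: "(\<lambda>n. m n k) \<longlonglongrightarrow> 0" if k: "k \<ge> 1" for k
  proof -
    have "(\<lambda>n. 1 / sqrt (real n)) \<longlonglongrightarrow> 0" by real_asymp
    from tendsto_power[OF this, of k] have "(\<lambda>n. (1 / sqrt (real n)) ^ k) \<longlonglongrightarrow> 0"
      using k by (simp add: power_0_left)
    from tendsto_add[OF tendsto_add[OF fX[OF k] fY[OF k]] this] show ?thesis
      unfolding m_def by simp
  qed
  have "?B \<longlonglongrightarrow> (1 - 1) + 1 * L * (3 * 0 + 3 ^ (4 * v + 1) * 0)"
    using v by (intro tendsto_intros lim_c lim_m) auto
  then have "?B \<longlonglongrightarrow> 0" by simp
  moreover have "\<forall>\<^sub>F n in sequentially. norm (real v * ?I n - 1) \<le> ?B n"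
    using eventually_ge_at_top[of 1] eventually_ge_at_top[of "2 * v"]
  proof eventually_elim
    case (elim n)
    interpret prob_space "M n" using prob elim by simp
    show ?case
      using expectation_cycle_count_bound[OF X[OF elim(1)] Y[OF elim(1)] indep[OF elim(1)]
          conj[OF elim(1)] elim v c_def m_def L_def] by simp
  qed
  ultimately have "(\<lambda>n. real v * ?I n - 1) \<longlonglongrightarrow> 0"
    by (rule Lim_null_comparison[rotated])
  from tendsto_mult[OF tendsto_const[of "1 / real v"] tendsto_add[OF this tendsto_const[of 1]]]
  show ?thesis using v by simp
qed

theorem proposition3:
  fixes M :: "nat \<Rightarrow> 'a measure"
    and \<sigma> :: "nat \<Rightarrow> nat \<Rightarrow> 'a \<Rightarrow> nat \<Rightarrow> nat"
    and t :: "nat \<Rightarrow> nat \<Rightarrow> 'a \<Rightarrow> nat"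
    and v :: nat
  assumes prob: "\<And>n. n \<ge> 1 \<Longrightarrow> prob_space (M n)"
    and random_perm: "\<And>l n. l \<in> {1, 2} \<Longrightarrow> n \<ge> 1 \<Longrightarrow> \<sigma> l n \<in> measurable (M n) (perm_space n)"
    and t_def: "\<And>n v \<omega>. t n v \<omega> = cycle_count n v (\<sigma> 1 n \<omega> \<circ> \<sigma> 2 n \<omega>)"
    and indep: "\<And>n. n \<ge> 1 \<Longrightarrow>
      prob_space.indep_var (M n) (perm_space n) (\<sigma> 1 n) (perm_space n) (\<sigma> 2 n)"
    and conj_inv: "\<exists>l\<^sub>0\<in>{1, 2}. \<forall>l\<in>{1, 2} - {l\<^sub>0}. \<forall>n\<ge>1. \<forall>\<tau>. \<tau> permutes {1..n} \<longrightarrow>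
      distr (M n) (perm_space n) (\<lambda>\<omega>. inv \<tau> \<circ> \<sigma> l n \<omega> \<circ> \<tau>) =
      distr (M n) (perm_space n) (\<sigma> l n)"
    and fixed_points: "\<And>l k. l \<in> {1, 2} \<Longrightarrow> k \<ge> 1 \<Longrightarrow>
      (\<lambda>n. \<integral>\<omega>. (real (cycle_count n 1 (\<sigma> l n \<omega>)) / sqrt (real n)) ^ k \<partial>M n) \<longlonglongrightarrow> 0"
    and v: "v \<ge> 1"
  shows "(\<lambda>n. \<integral>\<omega>. real (t n v \<omega>) \<partial>M n) \<longlonglongrightarrow> 1 / real v"
proof -
  have m: "\<sigma> 1 n \<in> measurable (M n) (perm_space n)" "\<sigma> 2 n \<in> measurable (M n) (perm_space n)"
    if "n \<ge> 1" for n using random_perm that by simp_all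
  have f: "(\<lambda>n. \<integral>\<omega>. (real (cycle_count n 1 (\<sigma> 1 n \<omega>)) / sqrt (real n)) ^ k \<partial>M n) \<longlonglongrightarrow> 0"
    "(\<lambda>n. \<integral>\<omega>. (real (cycle_count n 1 (\<sigma> 2 n \<omega>)) / sqrt (real n)) ^ k \<partial>M n) \<longlonglongrightarrow> 0"
    if "k \<ge> 1" for k using fixed_points that by simp_all
  have "(\<forall>n\<ge>1. \<forall>\<tau>. \<tau> permutes {1..n} \<longrightarrow>
        distr (M n) (perm_space n) (\<lambda>\<omega>. inv \<tau> \<circ> \<sigma> 1 n \<omega> \<circ> \<tau>) = distr (M n) (perm_space n) (\<sigma> 1 n)) \<or>
      (\<forall>n\<ge>1. \<forall>\<tau>. \<tau> permutes {1..n} \<longrightarrow>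
        distr (M n) (perm_space n) (\<lambda>\<omega>. inv \<tau> \<circ> \<sigma> 2 n \<omega> \<circ> \<tau>) = distr (M n) (perm_space n) (\<sigma> 2 n))"
    (is "?C1 \<or> ?C2")
  proof -
    obtain l\<^sub>0 :: nat where l: "l\<^sub>0 = 1 \<or> l\<^sub>0 = 2" and
      c: "\<forall>l\<in>{1, 2} - {l\<^sub>0}. \<forall>n\<ge>1. \<forall>\<tau>. \<tau> permutes {1..n} \<longrightarrow>
      distr (M n) (perm_space n) (\<lambda>\<omega>. inv \<tau> \<circ> \<sigma> l n \<omega> \<circ> \<tau>) =
      distr (M n) (perm_space n) (\<sigma> l n)" using conj_inv by blast
    show ?thesis
    proof (cases "l\<^sub>0 = 1")
      case True
      then have "(2::nat) \<in> {1, 2} - {l\<^sub>0}" by simp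
      with c have ?C2 by (rule bspec)
      then show ?thesis ..
    next
      case False
      then have "(1::nat) \<in> {1, 2} - {l\<^sub>0}" by simp
      with c have ?C1 by (rule bspec)
      then show ?thesis ..
    qed
  qed
  then show ?thesis
  proof
    assume ?C1
    then show ?thesis
      unfolding t_def by (intro expectation_cycle_count_tendsto prob m indep f v) auto
  next
    assume C2: ?C2
    have indep': "prob_space.indep_var (M n) (perm_space n) (\<sigma> 2 n) (perm_space n) (\<sigma> 1 n)"
      if "n \<ge> 1" for n
      using prob_space.indep_var_commute[OF prob[OF that] indep[OF that]] .
    have "(\<lambda>n. \<integral>\<omega>. real (cycle_count n v (\<sigma> 2 n \<omega> \<circ> \<sigma> 1 n \<omega>)) \<partial>M n) \<longlonglongrightarrow> 1 / real v"
      using C2 by (intro expectation_cycle_count_tendsto prob m indep' f v) auto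
    moreover have "\<forall>\<^sub>F n in sequentially.
        (\<integral>\<omega>. real (cycle_count n v (\<sigma> 2 n \<omega> \<circ> \<sigma> 1 n \<omega>)) \<partial>M n) = (\<integral>\<omega>. real (t n v \<omega>) \<partial>M n)"
      using eventually_ge_at_top[of 1]
    proof eventually_elim
      case (elim n)
      show ?case
        unfolding t_def
        using perm_space_permutes[OF m(1)[OF elim]] perm_space_permutes[OF m(2)[OF elim]]
        by (intro Bochner_Integration.integral_cong refl)
          (simp add: cycle_count_comp_commute[OF _ _ v])
    qed
    ultimately show ?thesis by (rule Lim_transform_eventually)
  qed
qed

end
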